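(* Let $k\ge3$ and $n=2k$, let $\ell=\frac{k-3}2$ if $k$ is odd and $\ell=\frac k2$ if $k$ is even, let $\eta\in\mathbb{F}_q^*$ and $\mathbf{v}=(v_1,\dots,v_n)\in(\mathbb{F}_q^* )^n$. Consider the twisted generalized elliptic curve code $\mathcal{C}(D,kO,\ell,\eta,\mathbf{v})$ over an elliptic curve of the third type ($y^2+y=x+\frac1{ax+b}$, $q$ even), with the notation of the context. 1. If $k$ is odd, $\mathcal{C}(D,kO,\ell,\eta,\mathbf{v})$ is self-dual if and only if $\sum_{i=1}^{n}\frac{\gamma_i}{a\alpha_i+b}\alpha_i^{k+1}=0$ and there exists $\lambda\in\mathbb{F}_q^*$ such that $v_i^2=\frac{\lambda\gamma_i}{a\alpha_i+b}$ for $i=1,\dots,n$. 2. If $k$ is even, $\mathcal{C}(D,kO,\ell,\eta,\mathbf{v})$ is self-dual if and only if $\sum_{i=1}^{n}\gamma_i(a\alpha_i+b)\alpha_i^{k-2}\beta_i=0$ and there exists $\mu\in\mathbb{F}_q^*$ such that $v_i^2=\frac{\mu\gamma_i}{a\alpha_i+b}$ for $i=1,\dots,n$.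
   Context: Third type: $q$ even, $F=\mathbb{F}_q(x,y)$ with $y^2+y=x+\frac{1}{ax+b}$, $a,b\in\mathbb{F}_q$, $a\ne0$; $O$ is the unique pole of $x$. Evaluation points: $T\subseteq\mathbb{F}_q$ is a set of $k$ elements $\alpha$ with $a\alpha+b\ne0$ for which $Y^2+Y=\alpha+\frac{1}{a\alpha+b}$ has (two) solutions in $\mathbb{F}_q$; $P_1,\dots,P_n$, $P_i=(\alpha_i,\beta_i)$ (i.e. $x(P_i)=\alpha_i$, $y(P_i)=\beta_i$), are all the $n=2k$ rational places with $x$-coordinate in $T$, and $D=P_1+\cdots+P_n$. Put $t=\prod_{\alpha\in T}(x-\alpha)$, $\omega=dx/t$, $\gamma_i=\mathrm{res}_{P_i}(\omega)$. Code: $\mathcal{C}(D,kO,\ell,\eta,\mathbf{v})=\{(v_1g(P_1),\dots,v_ng(P_n)): g\in S_\ell\}$, where for odd $k$ and $0\le\ell\le\frac{k-3}{2}$, $$S_\ell=\Big\{\sum_{i=0}^{(k-1)/2}a_ix^i+\sum_{j=0}^{(k-3)/2}b_jx^j(ax+b)y+b_\ell\eta x^{\frac{k+1}{2}}: a_i,b_j\in\mathbb{F}_q\Big\},$$ and for even $k$ and $0\le\ell\le\frac{k}{2}$, $$S_\ell=\Big\{\sum_{i=0}^{k/2}a_ix^i+\sum_{j=0}^{(k-4)/2}b_jx^j(ax+b)y+a_\ell\eta x^{\frac{k-2}{2}}(ax+b)y: a_i,b_j\in\mathbb{F}_q\Big\}.$$ Self-dual means equal to its Euclidean dual. *)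

theory Defs
  imports
    "Jordan_Normal_Form.Matrix"
    "HOL-Library.Cardinality"
    "HOL-Computational_Algebra.Formal_Laurent_Series"
begin

text \<open>
  A function field \<open>F/K\<close> is a field type \<open>'f\<close> together with an embedding
  \<open>emb :: 'k \<Rightarrow> 'f\<close> of the constant field. Places, valuation rings, residue classes,
  local expansions and residues of differentials are defined as in Stichtenoth,
  \<^emph>\<open>Algebraic Function Fields and Codes\<close>.
\<close>

definition is_subfield :: "'f::field set \<Rightarrow> bool" where
  "is_subfield S \<longleftrightarrow> 0 \<in> S \<and> 1 \<in> S \<and>
     (\<forall>u\<in>S. \<forall>w\<in>S. u - w \<in> S \<and> u * w \<in> S) \<and> (\<forall>u\<in>S. inverse u \<in> S)"

definition generated_field :: "'f::field set \<Rightarrow> 'f set" where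
  "generated_field A = \<Inter>{S. is_subfield S \<and> A \<subseteq> S}"

definition transcendental_over :: "('k::field \<Rightarrow> 'f::field) \<Rightarrow> 'f \<Rightarrow> bool" where
  "transcendental_over emb x \<longleftrightarrow> (\<forall>p. p \<noteq> 0 \<longrightarrow> poly (map_poly emb p) x \<noteq> 0)"

text \<open>The field \<open>F = K(x,y)\<close>, \<open>K\<close> finite of even cardinality, with \<open>y\<^sup>2 + y = x + 1/(ax+b)\<close>.\<close>

definition third_type_field ::
  "('k::{finite,field} \<Rightarrow> 'f::field) \<Rightarrow> 'f \<Rightarrow> 'f \<Rightarrow> 'k \<Rightarrow> 'k \<Rightarrow> bool" where
  "third_type_field emb x y a b \<longleftrightarrow>
     field_hom emb \<and> even CARD('k) \<and> a \<noteq> 0 \<and>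
     transcendental_over emb x \<and>
     y\<^sup>2 + y = x + 1 / (emb a * x + emb b) \<and>
     generated_field (range emb \<union> {x, y}) = UNIV"


subsection \<open>Places\<close>

definition valuation_ring :: "('k::field \<Rightarrow> 'f::field) \<Rightarrow> 'f set \<Rightarrow> bool" where
  "valuation_ring emb R \<longleftrightarrow>
     range emb \<subset> R \<and> R \<subset> UNIV \<and>
     (\<forall>u\<in>R. \<forall>w\<in>R. u - w \<in> R \<and> u * w \<in> R) \<and>
     (\<forall>z. z \<in> R \<or> inverse z \<in> R)"

text \<open>A place is the maximal ideal (the set of non-units) of a valuation ring.\<close>

definition is_place :: "('k::field \<Rightarrow> 'f::field) \<Rightarrow> 'f set \<Rightarrow> bool" where
  "is_place emb P \<longleftrightarrow>
     (\<exists>R. valuation_ring emb R \<and> P = R - {u \<in> R. \<exists>w\<in>R. u * w = 1})"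

text \<open>The valuation ring is determined by its maximal ideal. Zero is listed separately
  since \<open>inverse 0 = 0\<close>.\<close>

definition ring_of_place :: "'f::field set \<Rightarrow> 'f set" where
  "ring_of_place P = {z. z = 0 \<or> inverse z \<notin> P}"

definition rational_place :: "('k::field \<Rightarrow> 'f::field) \<Rightarrow> 'f set \<Rightarrow> bool" where
  "rational_place emb P \<longleftrightarrow>
     is_place emb P \<and> (\<forall>z\<in>ring_of_place P. \<exists>c. z - emb c \<in> P)"

text \<open>The value \<open>z(P)\<close>, meaningful for a rational place \<open>P\<close> and \<open>z \<in> ring_of_place P\<close>.\<close>

definition place_eval :: "('k::field \<Rightarrow> 'f::field) \<Rightarrow> 'f set \<Rightarrow> 'f \<Rightarrow> 'k" where
  "place_eval emb P z = (THE c. z - emb c \<in> P)"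

definition prime_element_at :: "'f::field set \<Rightarrow> 'f \<Rightarrow> bool" where
  "prime_element_at P s \<longleftrightarrow> P = (\<lambda>w. s * w) ` ring_of_place P"


subsection \<open>Residues of differentials\<close>

definition derivation_over :: "('k::field \<Rightarrow> 'f::field) \<Rightarrow> ('f \<Rightarrow> 'f) \<Rightarrow> bool" where
  "derivation_over emb \<delta> \<longleftrightarrow>
     (\<forall>c. \<delta> (emb c) = 0) \<and> (\<forall>u w. \<delta> (u + w) = \<delta> u + \<delta> w) \<and>
     (\<forall>u w. \<delta> (u * w) = u * \<delta> w + w * \<delta> u)"

text \<open>\<open>L\<close> is the \<open>P\<close>-adic power series expansion of \<open>z\<close> in the prime element \<open>s\<close>:
  the partial sums of \<open>L\<close> converge to \<open>z\<close> in the \<open>P\<close>-adic topology.\<close>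

definition local_expansion ::
  "('k::field \<Rightarrow> 'f::field) \<Rightarrow> 'f set \<Rightarrow> 'f \<Rightarrow> 'f \<Rightarrow> 'k fls \<Rightarrow> bool" where
  "local_expansion emb P s z L \<longleftrightarrow>
     (\<forall>N::int. z - (\<Sum>i = fls_subdegree L..N. emb (fls_nth L i) * s powi i)
        \<in> (\<lambda>w. s powi (N + 1) * w) ` ring_of_place P)"

text \<open>The residue of the differential \<open>u dw\<close> at a rational place \<open>P\<close>: for a prime element \<open>s\<close>
  one has \<open>u dw = u (dw/ds) ds\<close>, where \<open>d/ds\<close> is the derivation with value \<open>1\<close> at \<open>s\<close>,
  and the residue is the coefficient of \<open>1/s\<close> in the expansion of \<open>u (dw/ds)\<close>.
  It does not depend on \<open>s\<close>.\<close>

definition residue_at :: "('k::field \<Rightarrow> 'f::field) \<Rightarrow> 'f set \<Rightarrow> 'f \<Rightarrow> 'f \<Rightarrow> 'k" where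
  "residue_at emb P u w =
     (THE c. \<exists>s \<delta> L. prime_element_at P s \<and> derivation_over emb \<delta> \<and> \<delta> s = 1 \<and>
        local_expansion emb P s (u * \<delta> w) L \<and> c = fls_residue L)"


subsection \<open>Codes\<close>

definition euclidean_dual :: "nat \<Rightarrow> 'k::field vec set \<Rightarrow> 'k vec set" where
  "euclidean_dual n C = {w \<in> carrier_vec n. \<forall>c\<in>C. c \<bullet> w = 0}"

definition self_dual :: "nat \<Rightarrow> 'k::field vec set \<Rightarrow> bool" where
  "self_dual n C \<longleftrightarrow> C = euclidean_dual n C"

text \<open>The space \<open>S\<^sub>l\<close>. Its untwisted part is the standard basis of \<open>L(kO)\<close>, with \<open>O\<close> the unique
  pole of \<open>x\<close>, so \<open>O\<close> itself does not occur. Intended for \<open>k \<ge> 3\<close>, where the subtractions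
  are not truncated.\<close>

definition twisted_space ::
  "('k::field \<Rightarrow> 'f::field) \<Rightarrow> 'f \<Rightarrow> 'f \<Rightarrow> 'k \<Rightarrow> 'k \<Rightarrow> 'k \<Rightarrow> nat \<Rightarrow> nat \<Rightarrow> 'f set" where
  "twisted_space emb x y a b \<eta> k l =
     (if odd k then
        {(\<Sum>i = 0..(k - 1) div 2. emb (A i) * x ^ i)
         + (\<Sum>j = 0..(k - 3) div 2. emb (B j) * x ^ j * (emb a * x + emb b) * y)
         + emb (B l) * emb \<eta> * x ^ ((k + 1) div 2) | A B :: nat \<Rightarrow> 'k. True}
      else
        {(\<Sum>i = 0..k div 2. emb (A i) * x ^ i)
         + (\<Sum>j = 0..(k - 4) div 2. emb (B j) * x ^ j * (emb a * x + emb b) * y)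
         + emb (A l) * emb \<eta> * x ^ ((k - 2) div 2) * (emb a * x + emb b) * y
         | A B :: nat \<Rightarrow> 'k. True})"

text \<open>The code obtained by evaluating at \<open>P 0, \<dots>, P (n - 1)\<close> and scaling the coordinates by \<open>v\<close>.\<close>

definition twisted_code ::
  "('k::field \<Rightarrow> 'f::field) \<Rightarrow> 'f \<Rightarrow> 'f \<Rightarrow> 'k \<Rightarrow> 'k \<Rightarrow> nat \<Rightarrow> (nat \<Rightarrow> 'f set) \<Rightarrow>
   nat \<Rightarrow> nat \<Rightarrow> 'k \<Rightarrow> 'k vec \<Rightarrow> 'k vec set" where
  "twisted_code emb x y a b n P k l \<eta> v =
     {vec n (\<lambda>i. v $ i * place_eval emb (P i) g) | g. g \<in> twisted_space emb x y a b \<eta> k l}"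

end

theory Submission
  imports Defs "Jordan_Normal_Form.Char_Poly"
begin

text \<open>
  In characteristic 2 the two points above \<open>c \<in> T\<close> are \<open>(c, d)\<close> and \<open>(c, d + 1)\<close>, and \<open>x - c\<close> is a
  prime element at both, so \<open>\<gamma>\<^sub>i\<close> depends on \<open>c\<close> only: it is the inverse of the product of the
  \<open>c - c'\<close> with \<open>c' \<in> T - {c}\<close>. Summing over the fibres with weights \<open>\<gamma>\<^sub>i / (a\<alpha>\<^sub>i + b)\<close>, the product
  of \<open>p + q (ax + b) y\<close> and \<open>p' + q' (ax + b) y\<close> becomes the coefficient of \<open>x\<^sup>k\<^sup>-\<^sup>1\<close> in
  \<open>p q' + p' q + q q' (ax + b)\<close>. Conversely, enough monomials occur in products of two elements of
  the twisted space to force any weights annihilating all products to be multiples of these.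

  For odd \<open>k\<close> the coefficient in question vanishes by symmetry, and the sum in the criterion
  vanishes because its terms cancel in pairs. For even \<open>k\<close> the square of the twisted basis element
  contributes \<open>a\<eta>\<^sup>2 \<noteq> 0\<close> and the sum in the criterion is \<open>a \<noteq> 0\<close>, so both sides are false.
\<close>

text \<open>The places are given abstractly, so three facts have to come from the field equation:
  \<open>x - \<alpha>\<close> is a prime element at every place over an affine point over
  \<open>T\<close>, that place is determined by the point, and the residue is independent of the
  choices left open in \<open>residue_at\<close>. The first two come together: every nonzero element
  of \<open>F\<close> is a power of \<open>x - \<alpha>\<close> times an element that is a unit at
  all places over the point at once. The hypothesis supplies \<open>2 k\<close> places, so by
  uniqueness and counting they fill the \<open>2 k\<close> points over \<open>T\<close>. The third
  fact rests on \<open>F\<close> being spanned over its squares by 1 and \<open>x\<close>, which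
  makes every derivation a multiple of one explicit derivation \<open>D\<close>.

  For odd \<open>k\<close> the inclusion of the dual in the code is read off from degrees: an
  arbitrary word is interpolated by a pair of polynomials of degree below \<open>k\<close>,
  vanishing products with untwisted elements bound the two degrees, and the twisted element yields
  the relation between the top coefficients.\<close>

lemma power_card_eq_same:
  fixes c :: "'k::{finite,field}"
  shows "c ^ CARD('k) = c"
proof (cases "c = 0")
  case False
  \<comment> \<open>Fermat's argument: multiplication by \<open>c\<close> permutes the nonzero
    elements, whose product can be cancelled in the end.\<close>
  have "c * (\<Prod>d\<in>UNIV-{0}. c * d) = c * c ^ (CARD('k) - 1) * \<Prod>(UNIV-{0})"
    by (simp add: prod.distrib mult_ac)
  also have "c * c ^ (CARD('k) - 1) = c ^ Suc (CARD('k) - 1)"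
    by (subst power_Suc) auto
  also have "Suc (CARD('k) - 1) = CARD('k)"
    using finite_UNIV_card_ge_0[where ?'a = 'k] by simp
  also have "(\<Prod>d\<in>UNIV-{0}. c * d) = (\<Prod>d\<in>UNIV-{0}. d)"
    by (rule prod.reindex_bij_witness[of _ "\<lambda>d. d / c" "\<lambda>d. c * d"]) (use False in auto)
  finally show ?thesis
    by simp
qed (use finite_UNIV_card_ge_0[where ?'a = 'k] in auto)

text \<open>Raising \<open>-1\<close> to the even number of field elements gives 1, but it also
  gives back \<open>-1\<close>.\<close>

lemma even_card_imp_two_eq_0:
  assumes "even CARD('k::{finite,field})"
  shows "(2::'k) = 0"
proof -
  have "(-1::'k) ^ CARD('k) = 1"
    using assms by simp
  then have "(-1::'k) = 1"
    by (simp only: power_card_eq_same)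
  then show ?thesis
    by (metis add.right_inverse one_add_one)
qed

lemma even_card_imp_square:
  fixes c :: "'k::{finite,field}"
  assumes "even CARD('k)"
  obtains d where "d\<^sup>2 = c"
proof
  show "(c ^ (CARD('k) div 2))\<^sup>2 = c"
    using assms by (simp flip: power_mult add: power_card_eq_same)
qed

subsection \<open>Places\<close>

locale place = field_hom emb for emb :: "'k::field \<Rightarrow> 'f::field" +
  fixes Q :: "'f set"
  assumes is_place: "is_place emb Q"
begin

abbreviation R :: "'f set" where "R \<equiv> ring_of_place Q"

text \<open>For nonzero \<open>z\<close>, \<open>inverse z\<close> is a nonunit of \<open>R'\<close>
  exactly when \<open>z\<close> lies outside \<open>R'\<close>; hence \<open>ring_of_place\<close>
  recovers the ring that the place was made from.\<close>

lemma valuation_ring_R: "valuation_ring emb R"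
  and Q_eq: "Q = R - {u \<in> R. \<exists>w\<in>R. u * w = 1}"
proof -
  obtain R' where R': "valuation_ring emb R'" and Q: "Q = R' - {u \<in> R'. \<exists>w\<in>R'. u * w = 1}"
    using is_place unfolding is_place_def by blast
  have "0 \<in> R'"
    using R' hom_zero unfolding valuation_ring_def by (metis psubsetD rangeI)
  have "z \<in> R' \<longleftrightarrow> z = 0 \<or> inverse z \<notin> Q" for z
  proof (cases "z = 0")
    case False
    have "inverse z \<notin> Q" if "z \<in> R'"
      using that False Q by (auto intro!: bexI[of _ z])
    moreover have "z \<in> R'" if "inverse z \<notin> Q"
    proof (rule ccontr)
      assume "z \<notin> R'"
      then have "inverse z \<in> R'"
        using R' unfolding valuation_ring_def by blast
      then obtain w where "w \<in> R'" "inverse z * w = 1"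
        using \<open>inverse z \<notin> Q\<close> Q by blast
      then have "w = z"
        using False by (simp add: field_simps)
      then show False
        using \<open>w \<in> R'\<close> \<open>z \<notin> R'\<close> by simp
    qed
    ultimately show ?thesis
      using False by blast
  qed (use \<open>0 \<in> R'\<close> in simp)
  then have "R = R'"
    unfolding ring_of_place_def by blast
  then show "valuation_ring emb R" "Q = R - {u \<in> R. \<exists>w\<in>R. u * w = 1}"
    using R' Q by simp_all
qed

lemma emb_in_R [simp]: "emb c \<in> R"
  using valuation_ring_R unfolding valuation_ring_def by blast

lemma zero_in_R [simp]: "0 \<in> R" and one_in_R [simp]: "1 \<in> R"
  using emb_in_R[of 0] emb_in_R[of 1] by simp_all

lemma R_diff [simp]: "u \<in> R \<Longrightarrow> w \<in> R \<Longrightarrow> u - w \<in> R"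
  and R_mult [simp]: "u \<in> R \<Longrightarrow> w \<in> R \<Longrightarrow> u * w \<in> R"
  using valuation_ring_R unfolding valuation_ring_def by blast+

lemma R_uminus [simp]: "u \<in> R \<Longrightarrow> - u \<in> R"
  using R_diff[OF zero_in_R] by simp

lemma R_add [simp]: "u \<in> R \<Longrightarrow> w \<in> R \<Longrightarrow> u + w \<in> R"
  using R_diff[of u "- w"] by simp

lemma R_power [simp]: "u \<in> R \<Longrightarrow> u ^ m \<in> R"
  by (induction m) auto

lemma R_sum [simp]: "(\<And>i. i \<in> A \<Longrightarrow> f i \<in> R) \<Longrightarrow> sum f A \<in> R"
  by (induction A rule: infinite_finite_induct) auto

lemma R_prod [simp]: "(\<And>i. i \<in> A \<Longrightarrow> f i \<in> R) \<Longrightarrow> prod f A \<in> R"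
  by (induction A rule: infinite_finite_induct) auto

lemma R_or_inverse: "z \<in> R \<or> inverse z \<in> R"
  using valuation_ring_R unfolding valuation_ring_def by blast

lemma Q_subset_R: "z \<in> Q \<Longrightarrow> z \<in> R"
  using Q_eq by blast

lemma in_Q_iff: "z \<in> Q \<longleftrightarrow> z \<in> R \<and> (z = 0 \<or> inverse z \<notin> R)"
proof (cases "z = 0")
  case False
  have "(\<exists>w\<in>R. z * w = 1) \<longleftrightarrow> inverse z \<in> R"
    using False by (metis inverse_unique right_inverse)
  then show ?thesis
    using False Q_eq by blast
qed (use Q_eq in auto)

lemma inverse_in_R: "z \<in> R \<Longrightarrow> z \<notin> Q \<Longrightarrow> inverse z \<in> R"
  by (auto simp: in_Q_iff)

lemma zero_in_Q [simp]: "0 \<in> Q" and one_notin_Q [simp]: "1 \<notin> Q"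
  by (auto simp: in_Q_iff)

lemma Q_mult [simp]:
  assumes "u \<in> Q" "w \<in> R"
  shows "u * w \<in> Q" "w * u \<in> Q"
proof -
  have "inverse (u * w) \<notin> R" if "u * w \<noteq> 0"
  proof
    assume "inverse (u * w) \<in> R"
    then have "w * inverse (u * w) \<in> R"
      using assms by simp
    moreover have "w * inverse (u * w) = inverse u"
      using that by (simp add: field_simps)
    ultimately have "inverse u \<in> R"
      by (simp only:)
    then show False
      using assms that by (auto simp: in_Q_iff)
  qed
  then show "u * w \<in> Q"
    using Q_subset_R[OF assms(1)] assms(2) by (simp add: in_Q_iff) blast
  then show "w * u \<in> Q"
    by (simp add: mult.commute)
qed

lemma Q_uminus [simp]: "u \<in> Q \<Longrightarrow> - u \<in> Q"
  using Q_mult(1)[of u "-1"] by simp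

text \<open>Any two nonzero elements are comparable under divisibility in \<open>R\<close>, so the
  one that divides the other can be factored out of the sum.\<close>

lemma Q_add [simp]:
  assumes "u \<in> Q" "w \<in> Q"
  shows "u + w \<in> Q"
proof (cases "u = 0 \<or> w = 0")
  case False
  consider "u / w \<in> R" | "w / u \<in> R"
    using R_or_inverse[of "u / w"] by auto
  then show ?thesis
  proof cases
    case 1
    then have "w * (u / w + 1) \<in> Q"
      using assms by simp
    then show ?thesis
      using False by (simp add: field_simps)
  next
    case 2
    then have "u * (w / u + 1) \<in> Q"
      using assms by simp
    then show ?thesis
      using False by (simp add: field_simps)
  qed
qed (use assms in auto)

lemma Q_diff [simp]: "u \<in> Q \<Longrightarrow> w \<in> Q \<Longrightarrow> u - w \<in> Q"
  using Q_add[of u "- w"] by simp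

lemma Q_prime:
  assumes "u \<in> R" "w \<in> R" "u * w \<in> Q"
  shows "u \<in> Q \<or> w \<in> Q"
proof (rule ccontr)
  assume "\<not> ?thesis"
  then have "inverse u * (u * w) \<in> Q" "w \<notin> Q" "u \<noteq> 0"
    using assms by (auto simp: inverse_in_R)
  then show False
    by (simp flip: mult.assoc)
qed

lemma Q_power: "u \<in> R \<Longrightarrow> u ^ m \<in> Q \<Longrightarrow> u \<in> Q"
proof (induction m)
  case (Suc m)
  then show ?case
    using Q_prime[of u "u ^ m"] by auto
qed simp

text \<open>The instance for square roots of the fact that valuation rings are integrally
  closed.\<close>

lemma in_R_if_power_in_R:
  assumes "u\<^sup>2 \<in> R"
  shows "u \<in> R"
proof (rule ccontr)
  assume *: "u \<notin> R"
  then have "inverse u \<in> R"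
    using R_or_inverse by blast
  then have "u\<^sup>2 * inverse u \<in> R"
    using assms by simp
  moreover have "u\<^sup>2 * inverse u = u"
    using * by (auto simp: power2_eq_square field_simps)
  ultimately show False
    using * by simp
qed

lemma emb_in_Q_iff [simp]: "emb c \<in> Q \<longleftrightarrow> c = 0"
  using emb_in_R[of "inverse c"] by (auto simp: in_Q_iff hom_distribs)

lemma unit_mult:
  "u \<in> R \<Longrightarrow> u \<notin> Q \<Longrightarrow> w \<in> R \<Longrightarrow> w \<notin> Q \<Longrightarrow> u * w \<in> R \<and> u * w \<notin> Q"
  using Q_prime by auto

lemma unit_inverse: "u \<in> R \<Longrightarrow> u \<notin> Q \<Longrightarrow> inverse u \<in> R \<and> inverse u \<notin> Q"
  by (auto simp: in_Q_iff)

lemma Q_cong_mult: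
  assumes "u - u' \<in> Q" "w - w' \<in> Q" "u \<in> R" "w' \<in> R"
  shows "u * w - u' * w' \<in> Q"
proof -
  have "u * (w - w') + w' * (u - u') \<in> Q"
    using assms by simp
  then show ?thesis
    by (simp add: algebra_simps)
qed

lemma poly_in_R [simp]: "z \<in> R \<Longrightarrow> poly (map_poly emb p) z \<in> R"
  by (simp add: poly_altdef)

end

locale degree_one_place = place +
  assumes rational: "rational_place emb Q"
begin

abbreviation val :: "'b \<Rightarrow> 'a" where "val \<equiv> place_eval emb Q"

lemma val_unique:
  assumes "z - emb c \<in> Q"
  shows "val z = c"
  unfolding place_eval_def
proof (rule the_equality)
  fix d assume "z - emb d \<in> Q"
  then have "(z - emb d) - (z - emb c) \<in> Q"
    using assms by (rule Q_diff)
  moreover have "(z - emb d) - (z - emb c) = emb (c - d)"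
    by (simp add: hom_distribs)
  ultimately have "emb (c - d) \<in> Q"
    by (simp only:)
  then have "c - d = 0"
    by (simp only: emb_in_Q_iff)
  then show "d = c"
    by simp
qed (use assms in simp)

lemma val_cong: "z \<in> R \<Longrightarrow> z - emb (val z) \<in> Q"
proof -
  assume "z \<in> R"
  then obtain c where "z - emb c \<in> Q"
    using rational unfolding rational_place_def by blast
  then show ?thesis
    using val_unique by simp
qed

lemma val_emb [simp]: "val (emb c) = c"
  by (rule val_unique) simp

lemma val_zero [simp]: "val 0 = 0" and val_one [simp]: "val 1 = 1"
  using val_emb[of 0] val_emb[of 1] by simp_all

lemma val_add [simp]: "u \<in> R \<Longrightarrow> w \<in> R \<Longrightarrow> val (u + w) = val u + val w"
  using Q_add[OF val_cong val_cong] by (intro val_unique) (simp add: hom_distribs algebra_simps)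

lemma val_diff [simp]: "u \<in> R \<Longrightarrow> w \<in> R \<Longrightarrow> val (u - w) = val u - val w"
  using Q_diff[OF val_cong val_cong] by (intro val_unique) (simp add: hom_distribs algebra_simps)

lemma val_mult [simp]: "u \<in> R \<Longrightarrow> w \<in> R \<Longrightarrow> val (u * w) = val u * val w"
  using Q_cong_mult[OF val_cong val_cong] by (intro val_unique) (simp add: hom_distribs)

lemma val_power [simp]: "u \<in> R \<Longrightarrow> val (u ^ m) = val u ^ m"
  by (induction m) auto

lemma val_sum: "(\<And>i. i \<in> A \<Longrightarrow> f i \<in> R) \<Longrightarrow> val (sum f A) = (\<Sum>i\<in>A. val (f i))"
  by (induction A rule: infinite_finite_induct) auto

lemma val_prod: "(\<And>i. i \<in> A \<Longrightarrow> f i \<in> R) \<Longrightarrow> val (prod f A) = (\<Prod>i\<in>A. val (f i))"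
  by (induction A rule: infinite_finite_induct) auto

lemma val_eq_0_iff: "z \<in> R \<Longrightarrow> val z = 0 \<longleftrightarrow> z \<in> Q"
  using val_cong[of z] val_unique[of z 0] by auto

lemma val_inverse:
  assumes "z \<in> R" "z \<notin> Q"
  shows "val (inverse z) = inverse (val z)"
proof -
  have "val z * val (inverse z) = val (z * inverse z)"
    using assms inverse_in_R by (intro val_mult[symmetric]) auto
  also have "z * inverse z = 1"
    using assms by (intro right_inverse) auto
  finally show ?thesis
    by (metis inverse_unique val_one)
qed

lemma val_poly: "z \<in> R \<Longrightarrow> val (poly (map_poly emb p) z) = poly p (val z)"
  by (simp add: poly_altdef val_sum)

end

section \<open>Signs and squares in characteristic 2\<close>

lemma char2_add_self:
  fixes z :: "'a::comm_ring_1"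
  assumes "(2::'a) = 0"
  shows "z + z = 0"
  using assms by (metis mult_2 mult_zero_left)

lemma char2_uminus:
  fixes z :: "'a::comm_ring_1"
  assumes "(2::'a) = 0"
  shows "- z = z"
  using char2_add_self[OF assms, of z] by (simp add: add_eq_0_iff)

lemma char2_diff:
  fixes u w :: "'a::comm_ring_1"
  assumes "(2::'a) = 0"
  shows "u - w = u + w"
  using char2_uminus[OF assms, of w] by (metis add_uminus_conv_diff)

lemma char2_power2_add:
  fixes u w :: "'a::comm_ring_1"
  assumes "(2::'a) = 0"
  shows "(u + w)\<^sup>2 = u\<^sup>2 + w\<^sup>2"
  using assms by (simp add: power2_sum)

subsection \<open>Expansions at a place of degree one\<close>

context degree_one_place
begin

lemma prime_elementD:
  assumes "prime_element_at Q s"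
  shows "s \<in> Q" "s \<in> R" and "z \<in> Q \<Longrightarrow> \<exists>w\<in>R. z = s * w"
proof -
  have "s * 1 \<in> Q"
    using assms one_in_R unfolding prime_element_at_def by blast
  then show "s \<in> Q" "s \<in> R"
    using Q_subset_R by simp_all
  show "\<exists>w\<in>R. z = s * w" if "z \<in> Q"
    using assms that unfolding prime_element_at_def by blast
qed

text \<open>Simple poles suffice for the differential \<open>dx / t\<close>. Taking \<open>w\<close>
  to be a unit fixes the subdegree of the series, on which the partial sums in
  \<open>local_expansion\<close> depend.\<close>

lemma local_expansion_exists:
  assumes s: "prime_element_at Q s" "s \<noteq> 0" and w: "w \<in> R" "w \<notin> Q"
  shows "\<exists>L. local_expansion emb Q s (w / s) L"
proof -
  \<comment> \<open>Digit by digit: \<open>W n\<close> is the remainder of \<open>w\<close> after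
    \<open>n\<close> digits, and its value \<open>c n\<close> is the next digit.\<close>
  define W where "W = rec_nat w (\<lambda>_ z. (z - emb (val z)) / s)"
  define c where "c n = val (W n)" for n
  have W_0: "W 0 = w" and W_Suc: "W (Suc n) = (W n - emb (c n)) / s" for n
    by (simp_all add: W_def c_def)
  have W_R: "W n \<in> R" for n
  proof (induction n)
    case (Suc n)
    obtain r where "r \<in> R" "W n - emb (c n) = s * r"
      using prime_elementD(3)[OF s(1) val_cong[OF Suc]] unfolding c_def by blast
    then show ?case
      using s(2) by (simp add: W_Suc)
  qed (simp add: W_0 w)
  have w_eq: "w = (\<Sum>j<n. emb (c j) * s ^ j) + s ^ n * W n" for n
  proof (induction n)
    case (Suc n)
    have "s ^ n * W n = emb (c n) * s ^ n + s ^ Suc n * W (Suc n)"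
      using s(2) by (simp add: W_Suc field_simps)
    then show ?case
      using Suc by (simp add: add.assoc)
  qed (simp add: W_0)
  \<comment> \<open>The digits expand \<open>w\<close>; the shift by one accounts for the division
    by \<open>s\<close>. The digit \<open>c 0\<close> is nonzero because \<open>w\<close> is a unit,
    so the subdegree is exactly -1.\<close>
  define L where "L = fls_shift 1 (fps_to_fls (Abs_fps c))"
  have L_nth: "fls_nth L i = (if i < -1 then 0 else c (nat (i + 1)))" for i
    by (simp add: L_def)
  have "c 0 \<noteq> 0"
    using w val_eq_0_iff by (simp add: c_def W_0)
  then have sub: "fls_subdegree L = -1"
    by (intro fls_subdegree_eqI) (auto simp: L_nth)
  have "w / s - (\<Sum>i = -1..N. emb (fls_nth L i) * s powi i) \<in> (\<lambda>w. s powi (N + 1) * w) ` R" for N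
  proof (cases "N < -1")
    case True
    \<comment> \<open>The partial sum is empty here, so \<open>w / s\<close> itself must be a
      multiple of \<open>s powi (N + 1)\<close>; the cofactor is integral because
      \<open>- 2 - N\<close> is nonnegative.\<close>
    have "w / s = s powi (N + 1) * (s powi (- 2 - N) * w)"
      using s(2) by (simp add: power_int_add[symmetric] mult.assoc[symmetric] power_int_minus field_simps)
    also have "s powi (- 2 - N) = s ^ nat (- 2 - N)"
      using True by (simp add: power_int_def)
    finally have "w / s = s powi (N + 1) * (s ^ nat (- 2 - N) * w)" .
    then show ?thesis
      using True w(1) prime_elementD(2)[OF s(1)] by auto
  next
    case False
    define n where "n = nat (N + 1)"
    have N: "N = int n - 1"
      using False by (simp add: n_def)
    have powi: "s powi i = s ^ nat (i + 1) / s" if "i \<ge> -1" for i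
    proof -
      have "s powi i * s = s powi (i + 1)"
        using s(2) by (simp add: power_int_add)
      also have "\<dots> = s ^ nat (i + 1)"
        using that by (simp add: power_int_def)
      finally show ?thesis
        using s(2) by (simp add: field_simps)
    qed
    have "(\<Sum>i = -1..N. emb (fls_nth L i) * s powi i) = (\<Sum>j<Suc n. emb (c j) * s ^ j / s)"
      by (rule sum.reindex_bij_witness[of _ "\<lambda>j. int j - 1" "\<lambda>i. nat (i + 1)"])
        (auto simp: N L_nth powi)
    also have "\<dots> = (w - s ^ Suc n * W (Suc n)) / s"
      by (subst w_eq[of "Suc n"]) (simp only: sum_divide_distrib add_diff_cancel_right')
    also have "\<dots> = w / s - s powi (N + 1) * W (Suc n)"
      using s(2) by (simp add: N field_simps)
    finally have "w / s - (\<Sum>i = -1..N. emb (fls_nth L i) * s powi i) = s powi (N + 1) * W (Suc n)"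
      by simp
    then show ?thesis
      using W_R[of "Suc n"] by blast
  qed
  then have "local_expansion emb Q s (w / s) L"
    unfolding local_expansion_def sub by blast
  then show ?thesis
    by blast
qed

text \<open>The expansion is existentially quantified in \<open>residue_at\<close>, so every
  expansion has to give the same coefficient. One truncation decides each case of the subdegree:
  only -1 is consistent with a simple pole.\<close>

lemma local_expansion_residue:
  assumes s: "prime_element_at Q s" "s \<noteq> 0" and w: "w \<in> R" "w \<notin> Q"
    and L: "local_expansion emb Q s (w / s) L"
  shows "fls_residue L = val w"
proof -
  have exp: "\<exists>r\<in>R. w / s - (\<Sum>i = fls_subdegree L..N. emb (fls_nth L i) * s powi i) = s powi (N + 1) * r"
    for N
    using L unfolding local_expansion_def by blast
  consider "fls_subdegree L \<ge> 0" | "fls_subdegree L = -1" | "fls_subdegree L < -1"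
    by linarith
  then show ?thesis
  proof cases
    case 1
    then obtain r where "r \<in> R" "w / s = r"
      using exp[of "-1"] by auto
    then have "w = s * r"
      using s(2) by auto
    then show ?thesis
      using \<open>r \<in> R\<close> prime_elementD(1)[OF s(1)] w(2) by simp
  next
    case 2
    then obtain r where "r \<in> R" and r: "w / s - emb (fls_nth L (-1)) * s powi -1 = r"
      using exp[of "-1"] by auto
    have "w - emb (fls_nth L (-1)) = s * (w / s - emb (fls_nth L (-1)) * s powi -1)"
      using s(2) by (simp add: power_int_minus field_simps)
    also have "\<dots> \<in> Q"
      using \<open>r \<in> R\<close> r prime_elementD(1)[OF s(1)] by simp
    finally show ?thesis
      using val_unique by simp
  next
    case 3
    \<comment> \<open>Multiplying the truncation at \<open>d\<close> by \<open>s powi (-d)\<close>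
      puts the leading coefficient into \<open>Q\<close>, so it vanishes; but \<open>L\<close> is
      nonzero, since the zero series has subdegree 0.\<close>
    define d where "d = fls_subdegree L"
    obtain r where "r \<in> R" and r: "w / s - emb (fls_nth L d) * s powi d = s powi (d + 1) * r"
      using exp[of d] by (auto simp: d_def)
    have "d < -1"
      using 3 by (simp add: d_def)
    have e: "s powi (-d) * (w / s) - s powi (-d) * (emb (fls_nth L d) * s powi d)
        = s powi (-d) * (s powi (d + 1) * r)"
      using r by (metis right_diff_distrib)
    have e1: "s powi (-d) * (w / s) = s ^ nat (- d - 2) * s * w"
    proof -
      have "s powi (-d) = s powi (int (nat (- d - 2)) + 2)"
        using \<open>d < -1\<close> by simp
      also have "\<dots> = s ^ nat (- d - 2) * s * s"
        using s(2) by (subst power_int_add) (auto simp: power2_eq_square simp del: of_nat_nat int_nat_eq)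
      finally show ?thesis
        using s(2) by simp
    qed
    have e2: "s powi (-d) * (emb (fls_nth L d) * s powi d) = emb (fls_nth L d)"
      using s(2) by (simp add: power_int_minus)
    have e3: "s powi (-d) * (s powi (d + 1) * r) = s * r"
      using s(2) by (simp add: power_int_add power_int_minus)
    have "s ^ nat (- d - 2) * s * w - emb (fls_nth L d) = s * r"
      using e unfolding e1 e2 e3 .
    then have "emb (fls_nth L d) = s ^ nat (- d - 2) * s * w - s * r"
      by (simp add: algebra_simps)
    also have "\<dots> \<in> Q"
      using prime_elementD(1,2)[OF s(1)] w(1) \<open>r \<in> R\<close> by (intro Q_diff Q_mult) auto
    finally have "fls_nth L d = 0"
      by simp
    moreover have "L \<noteq> 0"
      using \<open>d < -1\<close> by (auto simp: d_def)
    ultimately show ?thesis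
      by (simp add: d_def)
  qed
qed

end

subsection \<open>The function field\<close>

locale third_type = field_hom emb for emb :: "'k::{finite,field} \<Rightarrow> 'f::field" +
  fixes x y :: 'f and a b :: 'k
  assumes field: "third_type_field emb x y a b"
begin

lemma even_card: "even CARD('k)"
  using field unfolding third_type_field_def by blast

lemma two_eq_0: "(2::'k) = 0" "(2::'f) = 0"
proof -
  show "(2::'k) = 0"
    using even_card by (rule even_card_imp_two_eq_0)
  then have "emb (1 + 1) = 0"
    by simp
  then show "(2::'f) = 0"
    by (simp add: hom_distribs)
qed

abbreviation ev :: "'k poly \<Rightarrow> 'f" where "ev p \<equiv> poly (map_poly emb p) x"

abbreviation h :: "'k poly" where "h \<equiv> [:b, a:]"

abbreviation Y :: 'f where "Y \<equiv> (emb a * x + emb b) * y"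

text \<open>Multiplying the equation of \<open>y\<close> by \<open>h\<^sup>2\<close> gives the monic
  equation \<open>Y\<^sup>2 + h Y = f\<close> with polynomial coefficients.\<close>

abbreviation f :: "'k poly" where "f \<equiv> h\<^sup>2 * [:0, 1:] + h"

interpretation map_poly: map_poly_inj_idom_hom emb ..

lemma ev_simps:
  "ev (p + q) = ev p + ev q" "ev (p - q) = ev p - ev q" "ev (p * q) = ev p * ev q"
  "ev (p ^ m) = ev p ^ m" "ev 0 = 0" "ev 1 = 1" "ev (- p) = - ev p"
  by (simp_all add: map_poly.hom_add map_poly.hom_minus map_poly.hom_mult map_poly.hom_power map_poly.hom_uminus)

lemma ev_pCons: "ev (pCons c p) = emb c + x * ev p"
  by (simp add: hom_distribs)

lemma ev_eq_0_iff: "ev p = 0 \<longleftrightarrow> p = 0"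
  using field unfolding third_type_field_def transcendental_over_def by auto

lemma a_nonzero: "a \<noteq> 0"
  using field unfolding third_type_field_def by blast

lemma ev_h: "ev h = emb a * x + emb b"
  by (simp add: ev_pCons ev_simps del: map_poly_pCons_hom)

lemma denominator_nonzero: "emb a * x + emb b \<noteq> 0"
  using ev_eq_0_iff[of h] a_nonzero unfolding ev_h by simp

lemma curve: "y\<^sup>2 + y = x + 1 / (emb a * x + emb b)"
  using field unfolding third_type_field_def by blast

lemma ev_f: "ev f = (ev h)\<^sup>2 * x + ev h"
  by (simp only: ev_simps) (simp add: hom_distribs)

lemma Y_equation: "Y\<^sup>2 + ev h * Y = ev f"
proof -
  have H: "H\<^sup>2 * (x + 1 / H) = H\<^sup>2 * x + H" if "H \<noteq> 0" for H
    using that by (simp add: power2_eq_square distrib_left)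
  have "Y\<^sup>2 + ev h * Y = (emb a * x + emb b)\<^sup>2 * (y\<^sup>2 + y)"
    by (simp only: ev_h) (simp add: power2_eq_square algebra_simps)
  also have "\<dots> = ev f"
    unfolding curve ev_f ev_h by (rule H[OF denominator_nonzero])
  finally show ?thesis .
qed

lemma Y_square: "Y\<^sup>2 = ev f - ev h * Y"
  using Y_equation by (metis add_diff_cancel_right')

lemma field_induct:
  assumes "is_subfield S" "range emb \<subseteq> S" "x \<in> S" "y \<in> S"
  shows "z \<in> S"
proof -
  have "generated_field (range emb \<union> {x, y}) \<subseteq> S"
    using assms unfolding generated_field_def by blast
  then show ?thesis
    using field unfolding third_type_field_def by blast
qed

text \<open>The second factor is the conjugate of the first: the two roots of
  \<open>Z\<^sup>2 + H Z = F\<close> add up to \<open>- H\<close>. The right-hand side is the norm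
  once the bracket is replaced by \<open>F\<close>.\<close>

lemma norm_aux:
  fixes A B H Z :: "'a::comm_ring_1"
  shows "(A + B * Z) * (A - B * H - B * Z) = A\<^sup>2 - A * B * H - B\<^sup>2 * (Z\<^sup>2 + H * Z)"
  by (simp add: power2_eq_square algebra_simps)

lemma product_aux:
  fixes A B F H Z :: "'a::comm_ring_1"
  assumes "Z\<^sup>2 = F - H * Z"
  shows "(A + B * Z) * (A' + B' * Z) = A * A' + B * B' * F + (A * B' + A' * B - B * B' * H) * Z"
proof -
  have "(A + B * Z) * (A' + B' * Z) = A * A' + (A * B' + A' * B) * Z + B * B' * Z\<^sup>2"
    by (simp add: power2_eq_square algebra_simps)
  then show ?thesis
    unfolding assms by (simp add: algebra_simps)
qed

lemma inverse_aux:
  fixes p q m d :: "'a::field"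
  assumes "p * q = m" "p \<noteq> 0" "m \<noteq> 0"
  shows "inverse (p / d) = d * q / m"
  using assms by (auto simp: field_simps)

lemma norm_eq:
  "(ev A + ev B * Y) * (ev A - ev B * ev h - ev B * Y) = ev (A\<^sup>2 - A * B * h - B\<^sup>2 * f)"
proof -
  have "(ev A + ev B * Y) * (ev A - ev B * ev h - ev B * Y)
      = (ev A)\<^sup>2 - ev A * ev B * ev h - (ev B)\<^sup>2 * (Y\<^sup>2 + ev h * Y)"
    by (rule norm_aux)
  then show ?thesis
    unfolding Y_equation by (simp only: ev_simps)
qed

lemma rational_form: "\<exists>A B C. C \<noteq> 0 \<and> z = (ev A + ev B * Y) / ev C"
proof -
  define S where "S = {z. \<exists>A B C. C \<noteq> 0 \<and> z = (ev A + ev B * Y) / ev C}"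
  have SI: "(ev A + ev B * Y) / ev C \<in> S" if "C \<noteq> 0" for A B C
    using that unfolding S_def by blast
  have SE: "\<exists>A B C. C \<noteq> 0 \<and> z = (ev A + ev B * Y) / ev C" if "z \<in> S" for z
    using that unfolding S_def by blast
  have diff: "u - w \<in> S" and mult: "u * w \<in> S" if "u \<in> S" "w \<in> S" for u w
  proof -
    obtain A B C where C: "C \<noteq> 0" and u: "u = (ev A + ev B * Y) / ev C"
      using SE[OF \<open>u \<in> S\<close>] by blast
    obtain A' B' C' where C': "C' \<noteq> 0" and w: "w = (ev A' + ev B' * Y) / ev C'"
      using SE[OF \<open>w \<in> S\<close>] by blast
    have nz: "ev C \<noteq> 0" "ev C' \<noteq> 0"
      using C C' ev_eq_0_iff by blast+
    have "u - w = (ev (A * C' - A' * C) + ev (B * C' - B' * C) * Y) / ev (C * C')"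
      unfolding u w ev_simps using nz by (simp add: field_simps)
    moreover have "(ev A + ev B * Y) * (ev A' + ev B' * Y)
        = ev (A * A' + B * B' * f) + ev (A * B' + A' * B - B * B' * h) * Y"
      using product_aux[OF Y_square, of "ev A" "ev B" "ev A'" "ev B'"] by (simp only: ev_simps)
    then have "u * w = (ev (A * A' + B * B' * f) + ev (A * B' + A' * B - B * B' * h) * Y) / ev (C * C')"
      unfolding u w by (simp only: times_divide_times_eq ev_simps(3)[of C])
    ultimately show "u - w \<in> S" "u * w \<in> S"
      using SI C C' by simp_all
  qed
  have inv: "inverse u \<in> S" if "u \<in> S" for u
  proof (cases "u = 0")
    case False
    obtain A B C where C: "C \<noteq> 0" and u: "u = (ev A + ev B * Y) / ev C"
      using SE[OF \<open>u \<in> S\<close>] by blast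
    define N where "N = A\<^sup>2 - A * B * h - B\<^sup>2 * f"
    have nz: "ev C \<noteq> 0" "ev A + ev B * Y \<noteq> 0"
      using C ev_eq_0_iff False u by auto
    show ?thesis
    proof (cases "N = 0")
      case True
      \<comment> \<open>A zero norm forces the conjugate to vanish. Then
        \<open>B Y = A - B h\<close>, so the numerator is the polynomial \<open>2 A - B h\<close> in
        \<open>x\<close> and its inverse is visibly in \<open>S\<close>.\<close>
      then have "ev A - ev B * ev h - ev B * Y = 0"
        using norm_eq[of A B] nz(2) ev_simps(5) unfolding N_def by (metis mult_eq_0_iff)
      then have *: "ev A + ev B * Y = ev (2 * A - B * h)"
        unfolding mult_2 ev_simps by (simp add: algebra_simps power2_eq_square)
      then have "inverse u = (ev C + ev 0 * Y) / ev (2 * A - B * h)"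
        unfolding u * ev_simps(5) by simp
      moreover have "2 * A - B * h \<noteq> 0"
        using nz(2) * ev_simps(5) by metis
      ultimately show ?thesis
        using SI by metis
    next
      case False
      then have "ev N \<noteq> 0"
        using ev_eq_0_iff by blast
      have "ev (C * (A - B * h)) + ev (- (C * B)) * Y = ev C * (ev A - ev B * ev h - ev B * Y)"
        unfolding ev_simps by (simp add: algebra_simps power2_eq_square)
      then have "inverse u = (ev (C * (A - B * h)) + ev (- (C * B)) * Y) / ev N"
        using inverse_aux[OF norm_eq[of A B, folded N_def] nz(2) \<open>ev N \<noteq> 0\<close>, of "ev C"]
        unfolding u by simp
      then show ?thesis
        using SI False by metis
    qed
  qed (use SI[of 1 0 0] in \<open>simp add: ev_simps\<close>)
  have embS: "emb c \<in> S" for c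
    using SI[of 1 "[:c:]" 0] by (simp add: ev_simps hom_distribs)
  have "is_subfield S"
    unfolding is_subfield_def using embS[of 0] embS[of 1] diff mult inv by simp
  moreover have "x \<in> S"
    using SI[of 1 "[:0, 1:]" 0] by (simp add: ev_simps)
  moreover have "y \<in> S"
  proof -
    have "y = (ev 0 + ev 1 * Y) / ev h"
      unfolding ev_simps ev_h using denominator_nonzero by simp
    then show ?thesis
      using SI[of h 0 1] a_nonzero by simp
  qed
  ultimately show ?thesis
    using field_induct[of S z] embS SE by blast
qed

text \<open>A finite field is perfect, so \<open>F\<close> is generated by \<open>x\<close> over its subfield of squares.\<close>

lemma square_decomposition: "\<exists>u w. z = u\<^sup>2 + x * w\<^sup>2"
proof -
  define S where "S = {z. \<exists>u w. z = u\<^sup>2 + x * w\<^sup>2}"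
  have SI: "u\<^sup>2 + x * w\<^sup>2 \<in> S" for u w
    unfolding S_def by blast
  have SE: "\<exists>u w. z = u\<^sup>2 + x * w\<^sup>2" if "z \<in> S" for z
    using that unfolding S_def by blast
  have add: "z + z' \<in> S" and mult: "z * z' \<in> S" if "z \<in> S" "z' \<in> S" for z z'
  proof -
    obtain u w u' w' where z: "z = u\<^sup>2 + x * w\<^sup>2" "z' = u'\<^sup>2 + x * w'\<^sup>2"
      using SE[OF \<open>z \<in> S\<close>] SE[OF \<open>z' \<in> S\<close>] by blast
    have "z + z' = (u + u')\<^sup>2 + x * (w + w')\<^sup>2"
      unfolding z char2_power2_add[OF two_eq_0(2)] by (simp add: algebra_simps power2_eq_square)
    moreover have "z * z' = (u * u' + x * w * w')\<^sup>2 + x * (u * w' + u' * w)\<^sup>2"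
      unfolding z char2_power2_add[OF two_eq_0(2)] by (simp add: algebra_simps power2_eq_square)
    ultimately show "z + z' \<in> S" "z * z' \<in> S"
      using SI by metis+
  qed
  have inv: "inverse z \<in> S" if "z \<in> S" for z
  proof -
    obtain u w where z: "z = u\<^sup>2 + x * w\<^sup>2"
      using SE[OF \<open>z \<in> S\<close>] by blast
    have "inverse z = z * (inverse z)\<^sup>2"
      by (cases "z = 0") (simp_all add: power2_eq_square)
    also have "\<dots> = (u * inverse z)\<^sup>2 + x * (w * inverse z)\<^sup>2"
      by (subst (1) z) (simp add: algebra_simps power_mult_distrib)
    finally show ?thesis
      using SI by metis
  qed
  have embS: "emb c \<in> S" for c
  proof -
    obtain d where "d\<^sup>2 = c"
      using even_card_imp_square[OF even_card] by blast
    then have "emb c = (emb d)\<^sup>2 + x * 0\<^sup>2"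
      by (auto simp: hom_distribs)
    then show ?thesis
      using SI by metis
  qed
  have xS: "x \<in> S"
    using SI[of 0 1] by simp
  have "is_subfield S"
    unfolding is_subfield_def char2_diff[OF two_eq_0(2)]
    using embS[of 0] embS[of 1] add mult inv by simp
  moreover have "y \<in> S"
  proof -
    have "y = y\<^sup>2 + (x + 1 / (emb a * x + emb b))"
      using curve char2_add_self[OF two_eq_0(2), of "y\<^sup>2"]
      by (metis add.assoc add_0)
    moreover have "y\<^sup>2 \<in> S"
      using SI[of y 0] by simp
    moreover have "1 / (emb a * x + emb b) \<in> S"
      using inv[OF add[OF mult[OF embS xS] embS]] by (simp add: divide_inverse)
    ultimately show ?thesis
      using add xS by metis
  qed
  ultimately show ?thesis
    using field_induct[of S z] embS xS SE by blast
qed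

end

subsection \<open>Rational points\<close>

locale point = third_type emb x y a b + degree_one_place emb Q
  for emb :: "'k::{finite,field} \<Rightarrow> 'f::field" and x y :: 'f and a b :: 'k and Q +
  fixes \<alpha> \<beta> :: 'k
  assumes x_in_R: "x \<in> ring_of_place Q"
    and val_x: "place_eval emb Q x = \<alpha>"
    and val_y: "place_eval emb Q y = \<beta>"
    and denominator: "a * \<alpha> + b \<noteq> 0"
begin

lemma denominator_in_R: "emb a * x + emb b \<in> R"
  and val_denominator: "val (emb a * x + emb b) = a * \<alpha> + b"
  by (simp_all add: x_in_R val_x)

lemma denominator_notin_Q: "emb a * x + emb b \<notin> Q"
  using denominator_in_R val_denominator denominator val_eq_0_iff by metis

lemma curve_rhs_in_R: "x + 1 / (emb a * x + emb b) \<in> R"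
  using denominator_in_R denominator_notin_Q x_in_R by (simp add: inverse_in_R divide_inverse)

text \<open>At a pole of \<open>y\<close>, division of the curve equation by
  \<open>y\<^sup>2\<close> would put 1 into \<open>Q\<close>. This gives \<open>val_y\<close> its
  meaning, since \<open>place_eval\<close> is meaningful on the ring only.\<close>

lemma y_in_R: "y \<in> R"
proof (rule ccontr)
  assume *: "y \<notin> R"
  then have "inverse y \<in> Q" "y \<noteq> 0"
    using R_or_inverse[of y] by (auto simp: in_Q_iff)
  then have "(y\<^sup>2 + y) * inverse y * inverse y - inverse y \<in> Q"
    unfolding curve using curve_rhs_in_R Q_subset_R by (intro Q_diff Q_mult) auto
  also have "(y\<^sup>2 + y) * inverse y * inverse y - inverse y = 1"
    using \<open>y \<noteq> 0\<close> by (simp add: field_simps power2_eq_square)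
  finally show False
    by simp
qed

lemma val_curve: "\<beta>\<^sup>2 + \<beta> = \<alpha> + 1 / (a * \<alpha> + b)"
proof -
  have "\<beta>\<^sup>2 + \<beta> = val (x + inverse (emb a * x + emb b))"
    using curve y_in_R val_y val_add[of "y\<^sup>2" y] by (simp add: divide_inverse)
  also have "\<dots> = \<alpha> + inverse (a * \<alpha> + b)"
    using x_in_R val_x val_inverse[OF denominator_in_R denominator_notin_Q]
      inverse_in_R[OF denominator_in_R denominator_notin_Q] val_denominator by simp
  finally show ?thesis
    by (simp add: divide_inverse)
qed

lemma ev_in_R: "ev p \<in> R" and val_ev: "val (ev p) = poly p \<alpha>"
  using val_poly[OF x_in_R] val_x by (simp_all add: x_in_R)

lemma Y_in_R: "Y \<in> R" and val_Y: "val Y = (a * \<alpha> + b) * \<beta>"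
  using denominator_in_R y_in_R val_denominator val_y by simp_all

end

section \<open>Factorisation by \<open>x - \<alpha>\<close> and uniqueness of the place over a
  point\<close>

context third_type
begin

text \<open>Quantifying over all places over the point makes a factorisation depend on the point
  alone; comparing two places by one factorisation is what yields
  \<open>point_unique\<close>.\<close>

definition units_at :: "'k \<Rightarrow> 'k \<Rightarrow> 'f set" where
  "units_at \<alpha> \<beta> = {u. \<forall>Q. point emb x y a b Q \<alpha> \<beta> \<longrightarrow> u \<in> ring_of_place Q \<and> u \<notin> Q}"

lemma units_at_mult: "u \<in> units_at \<alpha> \<beta> \<Longrightarrow> w \<in> units_at \<alpha> \<beta> \<Longrightarrow> u * w \<in> units_at \<alpha> \<beta>"
  unfolding units_at_def using point.axioms(2) degree_one_place.axioms(1) place.unit_mult by blast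

lemma units_at_inverse: "u \<in> units_at \<alpha> \<beta> \<Longrightarrow> inverse u \<in> units_at \<alpha> \<beta>"
  unfolding units_at_def using point.axioms(2) degree_one_place.axioms(1) place.unit_inverse by blast

lemma numerator_in_units_at:
  assumes "poly A \<alpha> + poly B \<alpha> * ((a * \<alpha> + b) * \<beta>) \<noteq> 0"
  shows "ev A + ev B * Y \<in> units_at \<alpha> \<beta>"
  unfolding units_at_def
proof safe
  fix Q assume "point emb x y a b Q \<alpha> \<beta>"
  then interpret point emb x y a b Q \<alpha> \<beta> .
  show "ev A + ev B * Y \<in> R"
    using ev_in_R Y_in_R by simp
  moreover have "val (ev A + ev B * Y) \<noteq> 0"
    using assms ev_in_R Y_in_R by (simp add: val_ev val_Y del: map_poly_pCons_hom)
  ultimately show "ev A + ev B * Y \<in> Q \<Longrightarrow> False"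
    using val_eq_0_iff by blast
qed

lemma ev_in_units_at: "poly p \<alpha> \<noteq> 0 \<Longrightarrow> ev p \<in> units_at \<alpha> \<beta>"
  using numerator_in_units_at[of p \<alpha> 0 \<beta>] by (simp add: ev_simps)

lemma ev_linear: "ev [:- \<alpha>, 1:] = x - emb \<alpha>"
  by (simp add: hom_distribs)

lemma x_minus_const_nonzero: "x - emb \<alpha> \<noteq> 0"
  using ev_eq_0_iff[of "[:- \<alpha>, 1:]"] ev_linear[of \<alpha>] by simp

lemma ev_decomposition:
  assumes "p \<noteq> 0"
  shows "\<exists>m u. u \<in> units_at \<alpha> \<beta> \<and> ev p = (x - emb \<alpha>) powi m * u"
proof -
  obtain q where q: "p = [:- \<alpha>, 1:] ^ order \<alpha> p * q" "\<not> [:- \<alpha>, 1:] dvd q"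
    using order_decomp[OF assms] by blast
  have "ev p = ev ([:- \<alpha>, 1:] ^ order \<alpha> p) * ev q"
    using q(1) ev_simps(3) by metis
  also have "ev ([:- \<alpha>, 1:] ^ order \<alpha> p) = (x - emb \<alpha>) powi int (order \<alpha> p)"
    by (simp only: ev_simps ev_linear power_int_of_nat)
  finally show ?thesis
    using ev_in_units_at[of q \<alpha> \<beta>] q(2) unfolding poly_eq_0_iff_dvd by blast
qed

text \<open>If a numerator without common factor \<open>x - \<alpha>\<close> vanishes at the point, then its conjugate does
  not, since the two values of \<open>y\<close> above \<open>\<alpha>\<close> differ; so its order is that of its norm.\<close>

lemma numerator_decomposition:
  assumes pt: "point emb x y a b Q \<alpha> \<beta>" and "ev A + ev B * Y \<noteq> 0"
  shows "\<exists>m u. u \<in> units_at \<alpha> \<beta> \<and> ev A + ev B * Y = (x - emb \<alpha>) powi m * u"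
  using assms(2)
proof (induction "degree A + degree B" arbitrary: A B rule: less_induct)
  case less
  define s where "s = x - emb \<alpha>"
  have "s \<noteq> 0"
    using x_minus_const_nonzero by (simp add: s_def)
  interpret point emb x y a b Q \<alpha> \<beta>
    by fact
  consider "poly A \<alpha> = 0" "poly B \<alpha> = 0" | "poly A \<alpha> + poly B \<alpha> * ((a * \<alpha> + b) * \<beta>) \<noteq> 0"
    | "poly A \<alpha> + poly B \<alpha> * ((a * \<alpha> + b) * \<beta>) = 0" "poly B \<alpha> \<noteq> 0"
    by force
  then show ?case
  proof cases
    case 1
    then obtain A' B' where A': "A = [:- \<alpha>, 1:] * A'" and B': "B = [:- \<alpha>, 1:] * B'"
      by (meson poly_eq_0_iff_dvd dvdE)
    have eq: "ev A + ev B * Y = s * (ev A' + ev B' * Y)"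
      unfolding A' B' ev_simps(3) ev_linear s_def by (simp add: algebra_simps power2_eq_square)
    have "A' \<noteq> 0 \<or> B' \<noteq> 0"
      using less.prems eq by (auto simp: ev_simps)
    then have "degree A' + degree B' < degree A + degree B"
      unfolding A' B' by (cases "A' = 0"; cases "B' = 0") (auto simp: degree_mult_eq simp del: mult_pCons_left mult_pCons_right)
    moreover have "ev A' + ev B' * Y \<noteq> 0"
      using less.prems eq by auto
    ultimately obtain m u where "u \<in> units_at \<alpha> \<beta>" "ev A' + ev B' * Y = s powi m * u"
      using less.hyps unfolding s_def by blast
    then have "ev A + ev B * Y = s powi (m + 1) * u"
      using eq \<open>s \<noteq> 0\<close> by (simp add: power_int_add)
    then show ?thesis
      using \<open>u \<in> units_at \<alpha> \<beta>\<close> unfolding s_def by blast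
  next
    case 2
    then show ?thesis
      using numerator_in_units_at by (metis mult_1 power_int_0_right)
  next
    case 3
    define C where "C = ev (A - B * h) + ev (- B) * Y"
    have "poly (A - B * h) \<alpha> + poly (- B) \<alpha> * ((a * \<alpha> + b) * \<beta>)
        = (poly A \<alpha> + poly B \<alpha> * ((a * \<alpha> + b) * \<beta>)) - poly B \<alpha> * (a * \<alpha> + b)
          - 2 * (poly B \<alpha> * ((a * \<alpha> + b) * \<beta>))"
      by (simp add: algebra_simps)
    also have "\<dots> \<noteq> 0"
      using 3 denominator by (simp add: two_eq_0)
    finally have "C \<in> units_at \<alpha> \<beta>"
      unfolding C_def by (rule numerator_in_units_at)
    then have "C \<noteq> 0"
      using pt unfolding units_at_def by auto
    define N where "N = A\<^sup>2 - A * B * h - B\<^sup>2 * f"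
    have C: "C = ev A - ev B * ev h - ev B * Y"
      unfolding C_def ev_simps by (simp add: algebra_simps power2_eq_square)
    have N: "(ev A + ev B * Y) * C = ev N"
      unfolding C N_def by (rule norm_eq)
    then have "N \<noteq> 0"
      using less.prems \<open>C \<noteq> 0\<close> ev_simps(5) by (metis mult_eq_0_iff)
    then obtain m u where u: "u \<in> units_at \<alpha> \<beta>" "ev N = s powi m * u"
      using ev_decomposition unfolding s_def by blast
    then have "ev A + ev B * Y = s powi m * (u * inverse C)"
      using N \<open>C \<noteq> 0\<close> by (simp add: field_simps)
    then show ?thesis
      using u(1) \<open>C \<in> units_at \<alpha> \<beta>\<close> units_at_mult units_at_inverse unfolding s_def by blast
  qed
qed

lemma decomposition:
  assumes pt: "point emb x y a b Q \<alpha> \<beta>" and "z \<noteq> 0"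
  shows "\<exists>m u. u \<in> units_at \<alpha> \<beta> \<and> z = (x - emb \<alpha>) powi m * u"
proof -
  obtain A B C where C: "C \<noteq> 0" and z: "z = (ev A + ev B * Y) / ev C"
    using rational_form by blast
  then obtain m u where u: "u \<in> units_at \<alpha> \<beta>" "ev A + ev B * Y = (x - emb \<alpha>) powi m * u"
    using numerator_decomposition[OF pt] \<open>z \<noteq> 0\<close> by (metis div_0)
  obtain m' u' where u': "u' \<in> units_at \<alpha> \<beta>" "ev C = (x - emb \<alpha>) powi m' * u'"
    using ev_decomposition[OF C] by blast
  have "z = (x - emb \<alpha>) powi (m - m') * (u * inverse u')"
    unfolding z u u' using x_minus_const_nonzero[of \<alpha>] by (simp add: power_int_diff field_simps)
  then show ?thesis
    using u(1) u'(1) units_at_mult units_at_inverse by blast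
qed

end

context point
begin

abbreviation s :: 'f where "s \<equiv> x - emb \<alpha>"

lemma s_in_Q: "s \<in> Q"
  using val_cong[OF x_in_R] val_x by simp

lemma s_nonzero: "s \<noteq> 0"
  by (rule x_minus_const_nonzero)

lemma decomposition_nat:
  assumes "z \<in> R" "z \<noteq> 0"
  shows "\<exists>m u. u \<in> units_at \<alpha> \<beta> \<and> z = s ^ m * u"
proof -
  obtain m u where u: "u \<in> units_at \<alpha> \<beta>" and z: "z = s powi m * u"
    using decomposition[OF point_axioms \<open>z \<noteq> 0\<close>] by blast
  \<comment> \<open>A negative exponent would turn the unit \<open>u\<close> into a multiple of
    \<open>s\<close> by an element of \<open>R\<close>.\<close>
  have "m \<ge> 0"
  proof (rule ccontr)
    assume "\<not> m \<ge> 0"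
    then obtain j where j: "m = - int (Suc j)"
      by (metis int_cases negative_zle_0 not_le_imp_less linorder_not_le of_nat_0_le_iff)
    have "s * (s ^ j * z) = s ^ Suc j * inverse (s ^ Suc j) * u"
      unfolding z j power_int_minus power_int_of_nat by (simp only: power_Suc mult.assoc)
    also have "s ^ Suc j * inverse (s ^ Suc j) = 1"
      using s_nonzero by (intro right_inverse power_not_zero)
    finally have "u = s * (s ^ j * z)"
      by simp
    also have "\<dots> \<in> Q"
      using s_in_Q Q_subset_R[OF s_in_Q] assms by (intro Q_mult) auto
    finally show False
      using u point_axioms unfolding units_at_def by blast
  qed
  then have "z = s ^ nat m * u"
    using z by (simp add: power_int_def)
  then show ?thesis
    using u by blast
qed

text \<open>A nonzero element of \<open>Q\<close> is a unit times a power of \<open>s\<close>, and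
  the exponent is positive because exponent 0 would leave a unit.\<close>

lemma prime_element_s: "prime_element_at Q s"
  unfolding prime_element_at_def
proof (intro equalityI subsetI)
  fix z assume z: "z \<in> Q"
  show "z \<in> (*) s ` R"
  proof (cases "z = 0")
    case False
    then obtain m u where u: "u \<in> units_at \<alpha> \<beta>" and zu: "z = s ^ m * u"
      using decomposition_nat[OF Q_subset_R[OF z]] by blast
    have uR: "u \<in> R" "u \<notin> Q"
      using u point_axioms unfolding units_at_def by auto
    then obtain j where "m = Suc j"
      using z zu by (cases m) auto
    then have "z = s * (s ^ j * u)"
      using zu by simp
    moreover have "s ^ j * u \<in> R"
      using uR Q_subset_R[OF s_in_Q] by simp
    ultimately show ?thesis
      by blast
  qed (auto intro!: image_eqI[of _ _ 0])
qed (use s_in_Q in auto)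

end

text \<open>In \<open>z = (x - \<alpha>)^m u\<close>, found at \<open>Q\<close>, the exponent is
  nonnegative and \<open>u\<close> is a unit at \<open>Q'\<close> as well, so \<open>z\<close> is
  integral at \<open>Q'\<close>.\<close>

lemma point_ring_subset:
  assumes "point emb x y a b Q \<alpha> \<beta>" "point emb x y a b Q' \<alpha> \<beta>"
  shows "ring_of_place Q \<subseteq> ring_of_place Q'"
proof
  interpret Q: point emb x y a b Q \<alpha> \<beta> by fact
  interpret Q': point emb x y a b Q' \<alpha> \<beta> by fact
  fix z assume "z \<in> Q.R"
  show "z \<in> Q'.R"
  proof (cases "z = 0")
    case False
    then obtain m u where "u \<in> Q.units_at \<alpha> \<beta>" "z = (x - emb \<alpha>) ^ m * u"
      using Q.decomposition_nat[OF \<open>z \<in> Q.R\<close>] by blast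
    then show ?thesis
      using assms(2) Q'.Q_subset_R[OF Q'.s_in_Q] unfolding Q.units_at_def by simp
  qed simp
qed

lemma point_unique:
  assumes "point emb x y a b Q \<alpha> \<beta>" "point emb x y a b Q' \<alpha> \<beta>"
  shows "Q = Q'"
proof -
  interpret Q: point emb x y a b Q \<alpha> \<beta> by fact
  interpret Q': point emb x y a b Q' \<alpha> \<beta> by fact
  have "Q.R = Q'.R"
    using point_ring_subset assms by blast
  then show ?thesis
    using Q.in_Q_iff Q'.in_Q_iff by blast
qed

subsection \<open>Residues at rational points\<close>

context third_type
begin

text \<open>A derivation in characteristic 2 kills squares, so this is \<open>d/dx\<close>.\<close>

definition D :: "'f \<Rightarrow> 'f" where
  "D z = (SOME w. \<exists>u. z = u\<^sup>2 + x * w\<^sup>2)\<^sup>2"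

lemma derivation_square:
  assumes "derivation_over emb \<delta>"
  shows "\<delta> (u\<^sup>2) = 0"
  using assms two_eq_0(2) unfolding derivation_over_def power2_eq_square by (metis mult_2 mult_zero_left)

end

context point
begin

text \<open>The valuation of a square is even, whereas that of \<open>x - \<alpha>\<close> is 1.\<close>

lemma x_not_square: "x \<noteq> r\<^sup>2"
proof
  assume x: "x = r\<^sup>2"
  obtain d where "d\<^sup>2 = \<alpha>"
    using even_card_imp_square[OF even_card] by blast
  then have "(r + emb d)\<^sup>2 = s"
    unfolding char2_power2_add[OF two_eq_0(2)] char2_diff[OF two_eq_0(2)] by (auto simp: x hom_distribs)
  then have "r + emb d \<in> Q"
    using s_in_Q Q_subset_R[OF s_in_Q] in_R_if_power_in_R Q_power by metis
  then obtain w where w: "w \<in> R" "r + emb d = s * w"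
    using prime_elementD(3)[OF prime_element_s] by blast
  then have "s * 1 = s * (s * w\<^sup>2)"
    using \<open>(r + emb d)\<^sup>2 = s\<close> by (metis mult.assoc mult.right_neutral power2_eq_square power_mult_distrib)
  then have "s * w\<^sup>2 = 1"
    using s_nonzero by (metis mult_left_cancel)
  then show False
    using w(1) s_in_Q by (metis Q_mult(1) R_power one_notin_Q)
qed

text \<open>Two representations with different \<open>w\<close> would exhibit \<open>x\<close> as a
  quotient of squares, hence as a square; so the choice in \<open>D\<close> is forced.\<close>

lemma D_eq: "D (u\<^sup>2 + x * w\<^sup>2) = w\<^sup>2"
proof -
  have "w' = w" if "u\<^sup>2 + x * w\<^sup>2 = u'\<^sup>2 + x * w'\<^sup>2" for u' w'
  proof (rule ccontr)
    assume "w' \<noteq> w"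
    have "(u + u')\<^sup>2 + x * (w + w')\<^sup>2 = (u\<^sup>2 + x * w\<^sup>2) + (u'\<^sup>2 + x * w'\<^sup>2)"
      unfolding char2_power2_add[OF two_eq_0(2)] by (simp add: algebra_simps)
    also have "\<dots> = 0"
      unfolding that by (rule char2_add_self[OF two_eq_0(2)])
    finally have "(u + u')\<^sup>2 = x * (w + w')\<^sup>2"
      by (metis add_eq_0_iff char2_uminus[OF two_eq_0(2)])
    moreover have "w + w' \<noteq> 0"
      using \<open>w' \<noteq> w\<close> by (metis add_eq_0_iff char2_uminus[OF two_eq_0(2)])
    ultimately have "x = ((u + u') / (w + w'))\<^sup>2"
      by (simp add: power_divide)
    then show False
      using x_not_square by blast
  qed
  then have "(SOME w'. \<exists>u'. u\<^sup>2 + x * w\<^sup>2 = u'\<^sup>2 + x * w'\<^sup>2) = w"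
    by (intro some_equality) blast+
  then show ?thesis
    unfolding D_def by simp
qed

lemma derivation_D: "derivation_over emb D"
  unfolding derivation_over_def
proof (intro conjI allI)
  show "D (emb c) = 0" for c
  proof -
    obtain d where "d\<^sup>2 = c"
      using even_card_imp_square[OF even_card] by blast
    then show ?thesis
      using D_eq[of "emb d" 0] by (auto simp: hom_distribs)
  qed
  fix z z'
  obtain u w u' w' where z: "z = u\<^sup>2 + x * w\<^sup>2" "z' = u'\<^sup>2 + x * w'\<^sup>2"
    using square_decomposition by metis
  have "z + z' = (u + u')\<^sup>2 + x * (w + w')\<^sup>2"
    unfolding z char2_power2_add[OF two_eq_0(2)] by (simp add: algebra_simps)
  then have "D (z + z') = (w + w')\<^sup>2"
    by (simp only: D_eq)
  then show "D (z + z') = D z + D z'"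
    by (simp only: z D_eq char2_power2_add[OF two_eq_0(2)])
  have "z * z' = (u * u' + x * w * w')\<^sup>2 + x * (u * w' + u' * w)\<^sup>2"
    unfolding z char2_power2_add[OF two_eq_0(2)] by (simp add: algebra_simps power2_eq_square)
  then have "D (z * z') = (u * w' + u' * w)\<^sup>2"
    by (simp only: D_eq)
  also have "\<dots> = (u * w')\<^sup>2 + (u' * w)\<^sup>2"
    by (rule char2_power2_add[OF two_eq_0(2)])
  \<comment> \<open>The Leibniz rule produces the term \<open>x w\<^sup>2 w'\<^sup>2\<close> twice,
    so zero is inserted in this shape.\<close>
  also have "\<dots> = (u * w')\<^sup>2 + (u' * w)\<^sup>2 + (x * w\<^sup>2 * w'\<^sup>2 + x * w\<^sup>2 * w'\<^sup>2)"
    by (simp add: char2_add_self[OF two_eq_0(2)])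
  also have "\<dots> = z * D z' + z' * D z"
    unfolding z D_eq by (simp add: algebra_simps power2_eq_square)
  finally show "D (z * z') = z * D z' + z' * D z" .
qed

lemma D_s: "D s = 1"
proof -
  have "D x = 1"
    using D_eq[of 0 1] by simp
  then have "D (s + emb \<alpha>) = 1"
    by simp
  then show ?thesis
    using derivation_D unfolding derivation_over_def by (metis add.right_neutral)
qed

text \<open>Squares are killed, so on \<open>u\<^sup>2 + x w\<^sup>2\<close> only the value at
  \<open>x\<close> matters. This controls the derivation that \<open>residue_at\<close> leaves
  open.\<close>

lemma derivation_eq:
  assumes "derivation_over emb \<delta>"
  shows "\<delta> z = \<delta> x * D z"
proof -
  obtain u w where z: "z = u\<^sup>2 + x * w\<^sup>2"
    using square_decomposition by blast
  have "\<delta> z = \<delta> (u\<^sup>2) + (x * \<delta> (w\<^sup>2) + w\<^sup>2 * \<delta> x)"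
    using assms unfolding z derivation_over_def by metis
  then show ?thesis
    unfolding derivation_square[OF assms] unfolding z D_eq by simp
qed

text \<open>A parity argument: \<open>u'\<^sup>2\<close> has even order and
  \<open>s w\<^sup>2\<close> odd order, so they cannot cancel and a pole of \<open>w\<close> would
  be a pole of \<open>z\<close>. Expressed by divisibility: after division by
  \<open>w\<^sup>2\<close>, a pole of \<open>w\<close> would make \<open>s\<close> a multiple of
  \<open>s\<^sup>2\<close>.\<close>

lemma D_in_R:
  assumes "z \<in> R"
  shows "D z \<in> R"
proof -
  obtain u w where z: "z = u\<^sup>2 + x * w\<^sup>2"
    using square_decomposition by blast
  obtain d where "d\<^sup>2 = \<alpha>"
    using even_card_imp_square[OF even_card] by blast
  then have d: "(emb d)\<^sup>2 = emb \<alpha>"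
    by (metis hom_power)
  \<comment> \<open>Absorbing the square root of \<open>\<alpha>\<close> into \<open>u\<close>
    replaces \<open>x\<close> by the prime element \<open>s\<close> and leaves \<open>w\<close>
    unchanged.\<close>
  define u' where "u' = u + emb d * w"
  have "u'\<^sup>2 + s * w\<^sup>2 = z"
    unfolding u'_def char2_power2_add[OF two_eq_0(2)] z power_mult_distrib d
    by (simp add: algebra_simps)
  have "w \<in> R"
  proof (rule ccontr)
    assume *: "w \<notin> R"
    then have "w \<noteq> 0" "inverse w \<in> Q"
      using R_or_inverse[of w] by (auto simp: in_Q_iff)
    have eq: "(u' * inverse w)\<^sup>2 = (inverse w)\<^sup>2 * z - s"
      using \<open>w \<noteq> 0\<close> by (simp flip: \<open>u'\<^sup>2 + s * w\<^sup>2 = z\<close> add: field_simps)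
    have "(inverse w)\<^sup>2 * z \<in> Q"
      using \<open>inverse w \<in> Q\<close> Q_subset_R[OF \<open>inverse w \<in> Q\<close>] assms
      unfolding power2_eq_square by simp
    then have "(inverse w)\<^sup>2 * z - s \<in> Q"
      using s_in_Q by (rule Q_diff)
    then have "u' * inverse w \<in> Q"
      using eq in_R_if_power_in_R Q_power Q_subset_R by metis
    then obtain r where r: "r \<in> R" "u' * inverse w = s * r"
      using prime_elementD(3)[OF prime_element_s] by blast
    obtain r' where r': "r' \<in> R" "inverse w = s * r'"
      using prime_elementD(3)[OF prime_element_s \<open>inverse w \<in> Q\<close>] by blast
    have "s * (s * (r'\<^sup>2 * z - r\<^sup>2)) = (s * r')\<^sup>2 * z - (s * r)\<^sup>2"
      by (simp add: power2_eq_square algebra_simps)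
    also have "\<dots> = (inverse w)\<^sup>2 * z - (u' * inverse w)\<^sup>2"
      by (simp only: r(2)[symmetric] r'(2)[symmetric])
    also have "\<dots> = s * 1"
      unfolding eq by simp
    finally have "s * (r'\<^sup>2 * z - r\<^sup>2) = 1"
      using s_nonzero by (metis mult_left_cancel)
    moreover have "s * (r'\<^sup>2 * z - r\<^sup>2) \<in> Q"
      using r(1) r'(1) assms s_in_Q by (intro Q_mult) auto
    ultimately show False
      using one_notin_Q by metis
  qed
  then show ?thesis
    unfolding z D_eq by simp
qed

text \<open>Existence uses \<open>s\<close> and \<open>D\<close>. For uniqueness, passing to
  \<open>s' = s e\<close> multiplies the numerator by \<open>e\<close> and by
  \<open>1 / D s'\<close>; since \<open>D s' = s D e + e\<close> has the same value as
  \<open>e\<close>, the two changes cancel at the place.\<close>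

lemma residue_simple_pole:
  assumes g: "g \<in> R" "g \<notin> Q"
  shows "residue_at emb Q (g / s) x = val g"
  unfolding residue_at_def
proof (rule the_equality)
  have "D x = 1"
    using D_eq[of 0 1] by simp
  obtain L where L: "local_expansion emb Q s (g / s) L"
    using local_expansion_exists[OF prime_element_s s_nonzero g] by blast
  then have "val g = fls_residue L"
    using local_expansion_residue[OF prime_element_s s_nonzero g] by simp
  then show "\<exists>s \<delta> L. prime_element_at Q s \<and> derivation_over emb \<delta> \<and> \<delta> s = 1 \<and>
      local_expansion emb Q s (g / (x - emb \<alpha>) * \<delta> x) L \<and> val g = fls_residue L"
    using prime_element_s derivation_D D_s L \<open>D x = 1\<close>
    by (intro exI[of _ s] exI[of _ D] exI[of _ L]) simp
next
  fix c
  assume "\<exists>s \<delta> L. prime_element_at Q s \<and> derivation_over emb \<delta> \<and> \<delta> s = 1 \<and>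
      local_expansion emb Q s (g / (x - emb \<alpha>) * \<delta> x) L \<and> c = fls_residue L"
  then obtain s' \<delta> L where s': "prime_element_at Q s'" and \<delta>: "derivation_over emb \<delta>" "\<delta> s' = 1"
    and L: "local_expansion emb Q s' (g / s * \<delta> x) L" and c: "c = fls_residue L"
    by blast
  obtain e where e: "e \<in> R" "s' = s * e"
    using prime_elementD(3)[OF prime_element_s prime_elementD(1)[OF s']] by blast
  obtain e' where e': "e' \<in> R" "s = s' * e'"
    using prime_elementD(3)[OF s' s_in_Q] by blast
  have "s * (e * e') = s * 1"
    using e(2) e'(2) by (metis mult.assoc mult.right_neutral)
  then have "e * e' = 1"
    using s_nonzero by (metis mult_left_cancel)
  then have "e \<notin> Q"
    using Q_mult(1)[of e e'] e'(1) by auto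
  have "s' \<noteq> 0" "e \<noteq> 0"
    using e' s_nonzero \<open>e * e' = 1\<close> by auto
  have Ds': "D s' = s * D e + e"
    using derivation_D unfolding derivation_over_def e(2) by (metis D_s mult.right_neutral)
  have R: "s * D e \<in> R" "D s' \<in> R"
    using e(1) D_in_R Q_subset_R[OF s_in_Q] unfolding Ds' by simp_all
  have "val (D s') = val e"
    using val_add[OF R(1) e(1)] val_eq_0_iff[OF R(1)] Q_mult(1)[OF s_in_Q D_in_R[OF e(1)]]
    unfolding Ds' by (metis add_0)
  then have "D s' \<notin> Q"
    using \<open>e \<notin> Q\<close> e(1) R val_eq_0_iff by metis
  have "\<delta> x * D s' = 1"
    using derivation_eq[OF \<delta>(1), of s'] \<delta>(2) by simp
  then have \<delta>x: "\<delta> x = inverse (D s')"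
    by (metis inverse_unique mult.commute)
  \<comment> \<open>The numerator of the differential with respect to \<open>s'\<close>; it is again
    a unit, so the coefficient is its value.\<close>
  define w where "w = g * (e * inverse (D s'))"
  have "g / z * r = g * (e * r) / (z * e)" for z r
    using \<open>e \<noteq> 0\<close> by (simp add: field_simps)
  then have "g / s * \<delta> x = w / s'"
    unfolding w_def \<delta>x e(2) by blast
  moreover have w: "w \<in> R" "w \<notin> Q"
    using unit_mult[OF g] unit_mult[OF e(1) \<open>e \<notin> Q\<close>] unit_inverse[OF R(2) \<open>D s' \<notin> Q\<close>]
    unfolding w_def by blast+
  ultimately have "c = val w"
    using local_expansion_residue[OF s' \<open>s' \<noteq> 0\<close> w] L c by simp
  also have "val w = val g * (val e * inverse (val e))"
    using g(1) e(1) inverse_in_R[OF R(2) \<open>D s' \<notin> Q\<close>] val_inverse[OF R(2) \<open>D s' \<notin> Q\<close>]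
      \<open>val (D s') = val e\<close> unfolding w_def by simp
  also have "val e * inverse (val e) = 1"
    using \<open>e \<notin> Q\<close> e(1) val_eq_0_iff by simp
  finally show "c = val g"
    by simp
qed

lemma residue_product:
  assumes "finite T" "\<alpha> \<in> T"
  shows "residue_at emb Q (1 / (\<Prod>c\<in>T. x - emb c)) x = 1 / (\<Prod>c\<in>T - {\<alpha>}. \<alpha> - c)"
proof -
  define p where "p = (\<Prod>c\<in>T - {\<alpha>}. x - emb c)"
  have p: "p \<in> R"
    unfolding p_def by (intro R_prod R_diff emb_in_R x_in_R)
  have "val p = (\<Prod>c\<in>T - {\<alpha>}. \<alpha> - c)"
    unfolding p_def by (subst val_prod) (simp_all add: x_in_R val_x)
  moreover have "(\<Prod>c\<in>T - {\<alpha>}. \<alpha> - c) \<noteq> 0"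
    using assms(1) by simp
  ultimately have "p \<notin> Q"
    using val_eq_0_iff[OF p] by metis
  have "1 / (\<Prod>c\<in>T. x - emb c) = inverse p / s"
    using assms by (simp add: prod.remove p_def divide_inverse mult.commute)
  then show ?thesis
    using residue_simple_pole[of "inverse p"] unit_inverse[OF p \<open>p \<notin> Q\<close>] val_inverse[OF p \<open>p \<notin> Q\<close>]
      \<open>val p = _\<close> by (simp add: divide_inverse)
qed

end

subsection \<open>Weighted power sums over a finite set\<close>

text \<open>The barycentric weights of Lagrange interpolation.\<close>

definition node_weight :: "'a::field set \<Rightarrow> 'a \<Rightarrow> 'a" where
  "node_weight T c = 1 / (\<Prod>d\<in>T - {c}. c - d)"

text \<open>The Lagrange basis polynomial, scaled so that for \<open>c\<close> in a finite
  \<open>T\<close> its leading coefficient is the barycentric weight.\<close>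

definition node_poly :: "'a::field set \<Rightarrow> 'a \<Rightarrow> 'a poly" where
  "node_poly T c = smult (node_weight T c) (\<Prod>d\<in>T - {c}. [:- d, 1:])"

lemma node_weight_nonzero: "finite T \<Longrightarrow> node_weight T c \<noteq> 0"
  by (simp add: node_weight_def)

lemma degree_prod_linear: "finite S \<Longrightarrow> degree (\<Prod>d\<in>S. [:- d, 1::'a::field:]) = card S"
  by (subst degree_prod_eq_sum_degree) auto

lemma degree_node_poly:
  "finite T \<Longrightarrow> c \<in> T \<Longrightarrow> degree (node_poly T c) = card T - 1"
  by (simp add: node_poly_def node_weight_nonzero degree_prod_linear del: mult_pCons_left)

lemma poly_node_poly:
  assumes "finite T" "c \<in> T" "d \<in> T"
  shows "poly (node_poly T c) d = (if d = c then 1 else 0)"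
  using assms by (auto simp: node_poly_def node_weight_def poly_prod)

lemma coeff_node_poly:
  assumes "finite T" "c \<in> T"
  shows "coeff (node_poly T c) (card T - 1) = node_weight T c"
proof -
  have "lead_coeff (\<Prod>d\<in>T - {c}. [:- d, 1:]) = 1"
    by (simp add: lead_coeff_prod)
  then show ?thesis
    using assms by (simp add: node_poly_def degree_prod_linear)
qed

lemma degree_sum_less':
  assumes "0 < n" "\<And>c. c \<in> T \<Longrightarrow> degree (p c) < n"
  shows "degree (\<Sum>c\<in>T. p c) < n"
  using assms by (induction T rule: infinite_finite_induct) (auto intro: degree_add_less)

lemma interpolation:
  fixes g :: "'a::field \<Rightarrow> 'a"
  assumes T: "finite T" "T \<noteq> {}"
  obtains p where "degree p < card T" "\<And>c. c \<in> T \<Longrightarrow> poly p c = g c"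
proof
  define p where "p = (\<Sum>c\<in>T. smult (g c) (node_poly T c))"
  have "0 < card T"
    using T by (simp add: card_gt_0_iff)
  then show "degree p < card T"
    unfolding p_def using T
    by (intro degree_sum_less' le_less_trans[OF degree_smult_le]) (auto simp: degree_node_poly)
  show "poly p c = g c" if "c \<in> T" for c
    using that T by (simp add: p_def poly_sum poly_node_poly if_distrib sum.delta cong: if_cong)
qed

text \<open>Comparison of top coefficients in the Lagrange interpolation formula for
  \<open>p\<close>.\<close>

lemma sum_node_weight_poly:
  assumes T: "finite T" "T \<noteq> {}" and p: "degree p < card T"
  shows "(\<Sum>c\<in>T. node_weight T c * poly p c) = coeff p (card T - 1)"
proof -
  define q where "q = (\<Sum>c\<in>T. smult (poly p c) (node_poly T c))"
  have "0 < card T"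
    using T by (simp add: card_gt_0_iff)
  then have "degree q < card T"
    unfolding q_def using T
    by (intro degree_sum_less' le_less_trans[OF degree_smult_le]) (auto simp: degree_node_poly)
  moreover have "poly q c = poly p c" if "c \<in> T" for c
    using that T by (simp add: q_def poly_sum poly_node_poly if_distrib sum.delta cong: if_cong)
  ultimately have "p = q"
    using p by (intro poly_eqI_degree[of T]) auto
  then have "coeff p (card T - 1) = coeff q (card T - 1)"
    by simp
  also have "\<dots> = (\<Sum>c\<in>T. node_weight T c * poly p c)"
    using T by (simp add: q_def coeff_sum coeff_node_poly mult.commute del: One_nat_def)
  finally show ?thesis ..
qed

lemma coeff_mult_top:
  assumes "degree p \<le> i" "degree q \<le> j"
  shows "coeff (p * q) (i + j) = coeff p i * coeff q j"
proof (cases "degree p = i \<and> degree q = j")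
  case True
  then show ?thesis
    using coeff_mult_degree_sum[of p q] by simp
next
  case False
  then have "degree (p * q) < i + j"
    using degree_mult_le[of p q] assms by linarith
  moreover have "coeff p i = 0 \<or> coeff q j = 0"
    using False assms by (auto intro!: coeff_eq_0)
  ultimately show ?thesis
    by (auto simp: coeff_eq_0)
qed

lemma poly_as_sum_below:
  fixes p :: "'a::comm_ring_1 poly"
  assumes "degree p < m"
  shows "poly p c = (\<Sum>i<m. coeff p i * c ^ i)"
  unfolding poly_altdef using assms
  by (intro sum.mono_neutral_left) (auto simp: coeff_eq_0)

lemma sum_poly_eq_0:
  fixes N :: "'a::field \<Rightarrow> 'a"
  assumes "\<And>j. j < m \<Longrightarrow> (\<Sum>c\<in>T. N c * c ^ j) = 0" and "degree p < m"
  shows "(\<Sum>c\<in>T. N c * poly p c) = 0"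
proof -
  have "(\<Sum>c\<in>T. N c * poly p c) = (\<Sum>i<m. coeff p i * (\<Sum>c\<in>T. N c * c ^ i))"
    unfolding poly_as_sum_below[OF assms(2)] sum_distrib_left
    by (subst sum.swap) (simp add: mult_ac)
  then show ?thesis
    using assms(1) by simp
qed

text \<open>Invertibility of the Vandermonde matrix, obtained by testing against the Lagrange basis
  polynomial at \<open>c\<close>.\<close>

lemma power_sums_eq_0:
  fixes N :: "'a::field \<Rightarrow> 'a"
  assumes T: "finite T" and "\<And>j. j < card T \<Longrightarrow> (\<Sum>c\<in>T. N c * c ^ j) = 0" and "c \<in> T"
  shows "N c = 0"
proof -
  have "0 < card T"
    using assms(1,3) by (auto simp: card_gt_0_iff)
  then have "degree (node_poly T c) < card T"
    using assms(1,3) by (simp add: degree_node_poly)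
  then have "(\<Sum>d\<in>T. N d * poly (node_poly T c) d) = 0"
    using sum_poly_eq_0 assms(2) by blast
  then show ?thesis
    using assms by (simp add: poly_node_poly if_distrib sum.delta cong: if_cong)
qed

text \<open>With one moment fewer the solutions form a line spanned by the node weights, whose last
  moment is 1. Hence \<open>r\<close> is the remaining moment of \<open>N\<close>, and subtracting
  \<open>r\<close> times the node weights kills every moment.\<close>

lemma power_sums_imp_node_weight:
  fixes N :: "'a::field \<Rightarrow> 'a"
  assumes T: "finite T" and N: "\<And>j. j < card T - 1 \<Longrightarrow> (\<Sum>c\<in>T. N c * c ^ j) = 0"
  obtains r where "\<And>c. c \<in> T \<Longrightarrow> N c = r * node_weight T c"
proof (cases "T = {}")
  case False
  define r where "r = (\<Sum>c\<in>T. N c * c ^ (card T - 1))"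
  have w: "(\<Sum>c\<in>T. node_weight T c * c ^ j) = (if j = card T - 1 then 1 else 0)" if "j < card T" for j
    using sum_node_weight_poly[OF T False, of "monom 1 j"] that
    by (simp add: poly_monom degree_monom_eq)
  have "(\<Sum>c\<in>T. (N c - r * node_weight T c) * c ^ j) = 0" if "j < card T" for j
  proof -
    have "(\<Sum>c\<in>T. (N c - r * node_weight T c) * c ^ j)
        = (\<Sum>c\<in>T. N c * c ^ j) - r * (\<Sum>c\<in>T. node_weight T c * c ^ j)"
      by (simp add: sum_subtractf sum_distrib_left algebra_simps)
    then show ?thesis
      using w[OF that] N[of j] that by (cases "j = card T - 1") (auto simp: r_def)
  qed
  then have "N c - r * node_weight T c = 0" if "c \<in> T" for c
    using power_sums_eq_0[OF T, of "\<lambda>c. N c - r * node_weight T c" c] that by blast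
  then show ?thesis
    using that by (metis eq_iff_diff_eq_0)
qed (use that in blast)

text \<open>The moments form a triangular system in the top coefficients of the polynomial.\<close>

lemma degree_less_if_moments_eq_0:
  assumes T: "finite T" "T \<noteq> {}" and p: "degree p < card T" and r: "r < card T"
    and m: "\<And>i. i < r \<Longrightarrow> (\<Sum>c\<in>T. node_weight T c * (c ^ i * poly p c)) = 0"
  shows "degree p < card T - r"
  using r m
proof (induction r)
  case (Suc r)
  then have deg: "degree p < card T - r"
    by simp
  have "degree (monom 1 r * p) < card T"
    using degree_mult_le[of "monom 1 r" p] deg Suc.prems(1) by (simp add: degree_monom_eq)
  then have "coeff (monom 1 r * p) (card T - 1) = 0"
    using sum_node_weight_poly[OF T, of "monom 1 r * p"] Suc.prems(2)[of r] by (simp add: poly_monom)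
  moreover have "card T - 1 = (card T - Suc r) + r"
    using Suc.prems(1) by simp
  ultimately have "coeff p (card T - Suc r) = 0"
    by (simp only: coeff_monom_mult) simp
  then have "degree p \<noteq> card T - Suc r"
    using Suc.prems(1) by (metis degree_0 leading_coeff_0_iff zero_less_diff less_irrefl)
  then show ?case
    using deg by linarith
qed (use p in simp)

section \<open>The weighted pairing on the points of the curve over \<open>T\<close>\<close>

definition curve_value :: "'k::field \<Rightarrow> 'k \<Rightarrow> 'k \<Rightarrow> 'k \<Rightarrow> 'k poly \<Rightarrow> 'k poly \<Rightarrow> 'k" where
  "curve_value a b c d p q = poly p c + poly q c * ((a * c + b) * d)"

text \<open>A pair \<open>(p, q)\<close> stands for the function \<open>p(x) + q(x) (ax + b) y\<close>.\<close>

definition odd_space :: "'k::field \<Rightarrow> nat \<Rightarrow> ('k poly \<times> 'k poly) set" where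
  "odd_space \<eta> m = {(p, q). degree p \<le> m + 1 \<and> degree q < m \<and> coeff p (m + 1) = \<eta> * coeff q (m - 1)}"

text \<open>In both spaces the coefficient reused by the twist is a leading one because
  \<open>l\<close> is extremal: \<open>l = m - 1\<close> belongs to \<open>q\<close> when
  \<open>k = 2 m + 1\<close>, and \<open>l = m\<close> to \<open>p\<close> when
  \<open>k = 2 m\<close>. The twist thus becomes one linear relation between top
  coefficients.\<close>

definition even_space :: "'k::field \<Rightarrow> nat \<Rightarrow> ('k poly \<times> 'k poly) set" where
  "even_space \<eta> m = {(p, q). degree p \<le> m \<and> degree q < m \<and> coeff q (m - 1) = \<eta> * coeff p m}"

locale curve_points =
  fixes a b :: "'k::field" and T :: "'k set" and \<beta>\<^sub>0 :: "'k \<Rightarrow> 'k"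
  assumes two: "(2::'k) = 0" and finite_T: "finite T" and a: "a \<noteq> 0"
    and denominator: "c \<in> T \<Longrightarrow> a * c + b \<noteq> 0"
    and curve: "c \<in> T \<Longrightarrow> (\<beta>\<^sub>0 c)\<^sup>2 + \<beta>\<^sub>0 c = c + 1 / (a * c + b)"
begin

abbreviation h :: "'k poly" where "h \<equiv> [:b, a:]"

text \<open>This is \<open>h\<^sup>2 X + h\<close> multiplied out. Its cubic term is what reaches
  the last moment in \<open>even_orthogonal_imp\<close>.\<close>

abbreviation f :: "'k poly" where "f \<equiv> [:b, a + b\<^sup>2, 2 * a * b, a\<^sup>2:]"

abbreviation cval :: "'k \<Rightarrow> 'k \<Rightarrow> 'k poly \<Rightarrow> 'k poly \<Rightarrow> 'k" where
  "cval \<equiv> curve_value a b"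

lemma add_self: "z + z = (0::'k)"
  using two by (metis mult_2 mult_zero_left)

lemma eq_iff_add: "u = w \<longleftrightarrow> u + w = (0::'k)"
  by (metis add_self add_right_cancel)

lemma value_mult:
  assumes c: "c \<in> T" and d: "d\<^sup>2 + d = c + 1 / (a * c + b)"
  shows "cval c d p q * cval c d p' q'
    = poly (p * p' + q * q' * f) c + poly (p * q' + p' * q + q * q' * h) c * ((a * c + b) * d)"
proof -
  define H where "H = a * c + b"
  have H: "poly h c = H" "H \<noteq> 0"
    using denominator[OF c] by (simp_all add: H_def algebra_simps)
  have f: "poly f c = H\<^sup>2 * c + H"
    by (simp add: H_def power2_eq_square algebra_simps)
  have "(H * d)\<^sup>2 + H * (H * d) = H\<^sup>2 * (d\<^sup>2 + d)"
    by (simp add: power2_eq_square algebra_simps)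
  also have "\<dots> = H\<^sup>2 * c + H"
    using H(2) unfolding d H_def[symmetric] by (simp add: power2_eq_square distrib_left)
  finally have Y: "(H * d)\<^sup>2 = poly f c + H * (H * d)"
    unfolding f by (metis add.assoc add.right_neutral add_self)
  have "cval c d p q * cval c d p' q'
      = poly p c * poly p' c + (poly p c * poly q' c + poly p' c * poly q c) * (H * d)
        + poly q c * poly q' c * (H * d)\<^sup>2"
    unfolding curve_value_def H_def[symmetric] by (simp add: power2_eq_square algebra_simps)
  also have "\<dots> = (poly p c * poly p' c + poly q c * poly q' c * poly f c)
      + (poly p c * poly q' c + poly p' c * poly q c + poly q c * poly q' c * H) * (H * d)"
    unfolding Y by (simp only: algebra_simps)
  finally show ?thesis
    unfolding poly_add poly_mult H(1) H_def[symmetric] .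
qed

text \<open>The weights \<open>U\<close> enter the pairing only through the two moments \<open>trace_sum\<close> and
  \<open>trace_sum_y\<close> along the fibre \<open>{\<beta>\<^sub>0 c, \<beta>\<^sub>0 c + 1}\<close> over \<open>c\<close>.\<close>

definition trace_sum :: "('k \<Rightarrow> 'k \<Rightarrow> 'k) \<Rightarrow> 'k \<Rightarrow> 'k" where
  "trace_sum U c = U c (\<beta>\<^sub>0 c) + U c (\<beta>\<^sub>0 c + 1)"

definition trace_sum_y :: "('k \<Rightarrow> 'k \<Rightarrow> 'k) \<Rightarrow> 'k \<Rightarrow> 'k" where
  "trace_sum_y U c = (a * c + b) * (U c (\<beta>\<^sub>0 c) * \<beta>\<^sub>0 c + U c (\<beta>\<^sub>0 c + 1) * (\<beta>\<^sub>0 c + 1))"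

definition pairing ::
  "('k \<Rightarrow> 'k \<Rightarrow> 'k) \<Rightarrow> 'k poly \<times> 'k poly \<Rightarrow> 'k poly \<times> 'k poly \<Rightarrow> 'k" where
  "pairing U = (\<lambda>(p, q) (p', q'). \<Sum>c\<in>T.
     U c (\<beta>\<^sub>0 c) * (cval c (\<beta>\<^sub>0 c) p q * cval c (\<beta>\<^sub>0 c) p' q')
     + U c (\<beta>\<^sub>0 c + 1) * (cval c (\<beta>\<^sub>0 c + 1) p q * cval c (\<beta>\<^sub>0 c + 1) p' q'))"

lemma curve': "c \<in> T \<Longrightarrow> (\<beta>\<^sub>0 c + 1)\<^sup>2 + (\<beta>\<^sub>0 c + 1) = c + 1 / (a * c + b)"
proof -
  assume c: "c \<in> T"
  have "(\<beta>\<^sub>0 c + 1)\<^sup>2 + (\<beta>\<^sub>0 c + 1) = ((\<beta>\<^sub>0 c)\<^sup>2 + \<beta>\<^sub>0 c) + 2 * (\<beta>\<^sub>0 c + 1)"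
    by (simp add: power2_eq_square algebra_simps)
  then show ?thesis
    unfolding curve[OF c] two by simp
qed

lemma pairing_eq:
  "pairing U (p, q) (p', q') =
    (\<Sum>c\<in>T. trace_sum U c * poly (p * p' + q * q' * f) c)
    + (\<Sum>c\<in>T. trace_sum_y U c * poly (p * q' + p' * q + q * q' * h) c)"
proof -
  have "u * (A + B * (H * d)) + u' * (A + B * (H * (d + 1)))
      = (u + u') * A + H * (u * d + u' * (d + 1)) * B" for u u' A B H d :: 'k
    by (simp add: algebra_simps)
  then show ?thesis
    unfolding pairing_def prod.case sum.distrib[symmetric] trace_sum_def trace_sum_y_def
    by (intro sum.cong refl) (simp only: value_mult[OF _ curve] value_mult[OF _ curve'])
qed

text \<open>In characteristic 2 a zero \<open>trace_sum\<close> says that the two weights on the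
  fibre agree. The second moment is then \<open>a c + b\<close> times the common weight, since the
  two ordinates add up to 1.\<close>

lemma weights_eq:
  assumes c: "c \<in> T" and M: "trace_sum U c = 0" and N: "trace_sum_y U c = r"
    and d: "d \<in> {\<beta>\<^sub>0 c, \<beta>\<^sub>0 c + 1}"
  shows "U c d = r / (a * c + b)"
proof -
  have eq: "U c (\<beta>\<^sub>0 c + 1) = U c (\<beta>\<^sub>0 c)"
    using M unfolding trace_sum_def by (metis eq_iff_add)
  have "r = (a * c + b) * (U c (\<beta>\<^sub>0 c) + (U c (\<beta>\<^sub>0 c) * \<beta>\<^sub>0 c + U c (\<beta>\<^sub>0 c) * \<beta>\<^sub>0 c))"
    unfolding N[symmetric] trace_sum_y_def eq by (simp add: algebra_simps)
  then show ?thesis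
    using d denominator[OF c] eq by (auto simp: add_self)
qed

lemma trace_sums_of_weights:
  assumes c: "c \<in> T" and "U c (\<beta>\<^sub>0 c) = r / (a * c + b)" "U c (\<beta>\<^sub>0 c + 1) = r / (a * c + b)"
  shows "trace_sum U c = 0" "trace_sum_y U c = r"
proof -
  show "trace_sum U c = 0"
    unfolding trace_sum_def assms by (rule add_self)
  have "H * (q * d + q * (d + 1)) = H * (q + (q * d + q * d))" for H q d :: 'k
    by (simp add: algebra_simps)
  then have "trace_sum_y U c = (a * c + b) * (r / (a * c + b) + (r / (a * c + b) * \<beta>\<^sub>0 c + r / (a * c + b) * \<beta>\<^sub>0 c))"
    unfolding trace_sum_y_def assms by blast
  then show "trace_sum_y U c = r"
    using denominator[OF c] by (simp add: add_self)
qed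

text \<open>Powers of \<open>x\<close> up to \<open>m\<close> have products up to
  \<open>2 m\<close>, which gives all \<open>card T\<close> moments of \<open>trace_sum\<close>. For
  \<open>trace_sum_y\<close> the products reach \<open>2 m - 1\<close>, one short, which leaves the
  scalar \<open>r\<close>.\<close>

lemma odd_orthogonal_imp:
  assumes T: "card T = 2 * m + 1" and m: "m \<ge> 1"
    and orth: "\<And>g g'. g \<in> odd_space \<eta> m \<Longrightarrow> g' \<in> odd_space \<eta> m \<Longrightarrow> pairing U g g' = 0"
  obtains r where "\<And>c. c \<in> T \<Longrightarrow> trace_sum U c = 0"
    and "\<And>c. c \<in> T \<Longrightarrow> trace_sum_y U c = r * node_weight T c"
proof -
  have M: "trace_sum U c = 0" if "c \<in> T" for c
  proof (rule power_sums_eq_0[OF finite_T _ that])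
    fix j assume "j < card T"
    \<comment> \<open>Splits the exponent \<open>j \<le> 2 m\<close> into two exponents that are at
      most \<open>m\<close>.\<close>
    define i where "i = min j m"
    have i: "i \<le> m" "j - i \<le> m" "i + (j - i) = j"
      using \<open>j < card T\<close> T by (auto simp: i_def)
    have "(monom 1 i, 0) \<in> odd_space \<eta> m" "(monom 1 (j - i), 0) \<in> odd_space \<eta> m"
      using i m by (auto simp: odd_space_def degree_monom_eq)
    then have "pairing U (monom 1 i, 0) (monom 1 (j - i), 0) = 0"
      by (rule orth)
    then show "(\<Sum>c\<in>T. trace_sum U c * c ^ j) = 0"
      unfolding pairing_eq using i(3) by (simp add: mult_monom poly_monom)
  qed
  have "(\<Sum>c\<in>T. trace_sum_y U c * c ^ j) = 0" if "j < card T - 1" for j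
  proof (cases "j < m - 1")
    case True
    have "(1, 0) \<in> odd_space \<eta> m" "(0, monom 1 j) \<in> odd_space \<eta> m"
      using True by (auto simp: odd_space_def degree_monom_eq)
    then have "pairing U (1, 0) (0, monom 1 j) = 0"
      by (rule orth)
    then show ?thesis
      unfolding pairing_eq by (simp add: poly_monom)
  next
    case False
    \<comment> \<open>The factor \<open>x^(m-1)\<close> occurs only inside the twisted element; its
      other component meets \<open>trace_sum\<close> alone, which is already zero.\<close>
    have "(monom 1 (j - (m - 1)), 0) \<in> odd_space \<eta> m"
      "(monom \<eta> (m + 1), monom 1 (m - 1)) \<in> odd_space \<eta> m"
      using that False T m
      by (auto simp: odd_space_def degree_monom_eq intro: order_trans[OF degree_monom_le])
    then have "pairing U (monom 1 (j - (m - 1)), 0) (monom \<eta> (m + 1), monom 1 (m - 1)) = 0"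
      by (rule orth)
    moreover have "j - (m - 1) + (m - 1) = j"
      using False by simp
    ultimately show ?thesis
      unfolding pairing_eq by (simp add: M mult_monom poly_monom)
  qed
  then obtain r where "\<And>c. c \<in> T \<Longrightarrow> trace_sum_y U c = r * node_weight T c"
    using power_sums_imp_node_weight[OF finite_T, of "trace_sum_y U"] by blast
  then show thesis
    using that M by blast
qed

text \<open>Here \<open>x^m\<close> is tied to the twist, so powers of \<open>x\<close> miss the
  last moment of \<open>trace_sum\<close>. It is recovered from a square of a multiple of
  \<open>(a x + b) y\<close>; pairing the twisted element with itself then removes the last free
  scalar.\<close>

lemma even_orthogonal_imp:
  assumes T: "card T = 2 * m" and m: "m \<ge> 2" and \<eta>: "\<eta> \<noteq> 0"
    and orth: "\<And>g g'. g \<in> even_space \<eta> m \<Longrightarrow> g' \<in> even_space \<eta> m \<Longrightarrow> pairing U g g' = 0"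
    and c: "c \<in> T"
  shows "trace_sum U c = 0" "trace_sum_y U c = 0"
proof -
  obtain j where m_eq: "m = j + 2"
    using m by (metis le_add_diff_inverse2)
  have X: "(monom 1 i, 0) \<in> even_space \<eta> m" if "i < m" for i
    using that by (auto simp: even_space_def degree_monom_eq)
  have XY: "(0, monom 1 i) \<in> even_space \<eta> m" if "i < m - 1" for i
    using that by (auto simp: even_space_def degree_monom_eq)
  have e: "(monom 1 m, monom \<eta> (m - 1)) \<in> even_space \<eta> m"
    using m \<eta> by (auto simp: even_space_def degree_monom_eq)
  have M_low: "(\<Sum>c\<in>T. trace_sum U c * c ^ i) = 0" if "i < 2 * m - 1" for i
  proof -
    define i' where "i' = min i (m - 1)"
    have i': "i' < m" "i - i' < m" "i' + (i - i') = i"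
      using that m by (auto simp: i'_def)
    have "pairing U (monom 1 i', 0) (monom 1 (i - i'), 0) = 0"
      using X i' by (intro orth) auto
    then show ?thesis
      unfolding pairing_eq using i'(3) by (simp add: mult_monom poly_monom)
  qed
  have N_low: "(\<Sum>c\<in>T. trace_sum_y U c * c ^ i) = 0" if "i < 2 * m - 2" for i
  proof -
    define i' where "i' = min i (m - 1)"
    have i': "i' < m" "i - i' < m - 1" "i' + (i - i') = i"
      using that m by (auto simp: i'_def)
    have "pairing U (monom 1 i', 0) (0, monom 1 (i - i')) = 0"
      using X XY i' by (intro orth) auto
    then show ?thesis
      unfolding pairing_eq using i'(3) by (simp add: mult_monom poly_monom)
  qed
  \<comment> \<open>The square of \<open>x^j (a x + b) y\<close> with \<open>j = m - 2\<close>
    involves \<open>x^(2 j) f\<close>, of degree exactly \<open>2 m - 1\<close> with leading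
    coefficient \<open>a\<^sup>2\<close>. The lower terms fall under \<open>M_low\<close>, the
    \<open>h\<close> part under \<open>N_low\<close>.\<close>
  have M_top: "(\<Sum>c\<in>T. trace_sum U c * c ^ (2 * m - 1)) = 0"
  proof -
    define g where "g = [:b, a + b\<^sup>2, 2 * a * b:]"
    have "degree g \<le> 2"
      by (simp add: g_def)
    then have "degree (monom 1 (2 * j) * g) < 2 * m - 1"
      using degree_mult_le[of "monom 1 (2 * j)" g] by (simp add: degree_monom_eq m_eq)
    then have g: "(\<Sum>c\<in>T. trace_sum U c * poly (monom 1 (2 * j) * g) c) = 0"
      using sum_poly_eq_0 M_low by blast
    have "degree (monom 1 (2 * j) * h) < 2 * m - 2"
      using degree_mult_le[of "monom 1 (2 * j)" h] a by (simp add: degree_monom_eq m_eq)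
    then have h: "(\<Sum>c\<in>T. trace_sum_y U c * poly (monom 1 (2 * j) * h) c) = 0"
      using sum_poly_eq_0 N_low by blast
    have "pairing U (0, monom 1 j) (0, monom 1 j) = 0"
      using XY by (intro orth) (auto simp: m_eq)
    then have "(\<Sum>c\<in>T. trace_sum U c * poly (monom 1 (2 * j) * f) c) = 0"
      using h unfolding pairing_eq by (simp add: mult_monom flip: mult_2 del: mult_pCons_right)
    moreover have "trace_sum U c * poly (monom 1 (2 * j) * f) c
        = trace_sum U c * poly (monom 1 (2 * j) * g) c + a\<^sup>2 * (trace_sum U c * c ^ (2 * m - 1))" for c
    proof -
      have "2 * m - 1 = 2 * j + 3"
        by (simp add: m_eq)
      then have "c ^ (2 * m - 1) = c ^ (2 * j) * c ^ 3"
        by (simp only: power_add)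
      then show ?thesis
        by (simp add: g_def poly_monom algebra_simps power3_eq_cube)
    qed
    ultimately have "a\<^sup>2 * (\<Sum>c\<in>T. trace_sum U c * c ^ (2 * m - 1)) = 0"
      using g by (simp add: sum.distrib sum_distrib_left)
    then show ?thesis
      using a by simp
  qed
  have M: "trace_sum U c = 0" if "c \<in> T" for c
  proof (rule power_sums_eq_0[OF finite_T _ that])
    fix i assume "i < card T"
    then show "(\<Sum>c\<in>T. trace_sum U c * c ^ i) = 0"
      using M_low[of i] M_top T by (cases "i = 2 * m - 1") auto
  qed
  have "(\<Sum>c\<in>T. trace_sum_y U c * c ^ i) = 0" if "i < card T - 1" for i
  proof (cases "i < 2 * m - 2")
    case False
    \<comment> \<open>The only exponent left is \<open>2 m - 2\<close>; the twisted element supplies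
      it with the factor \<open>\<eta>\<close>.\<close>
    then have i: "i = (m - 1) + (m - 1)"
      using that T by simp
    have "pairing U (monom 1 (m - 1), 0) (monom 1 m, monom \<eta> (m - 1)) = 0"
      using X e m by (intro orth) auto
    then have "\<eta> * (\<Sum>c\<in>T. trace_sum_y U c * c ^ i) = 0"
      unfolding pairing_eq i by (simp add: M mult_monom poly_monom sum_distrib_left mult_ac)
    then show ?thesis
      using \<eta> by simp
  qed (rule N_low)
  then obtain r where r: "\<And>c. c \<in> T \<Longrightarrow> trace_sum_y U c = r * node_weight T c"
    using power_sums_imp_node_weight[OF finite_T, of "trace_sum_y U"] by blast
  \<comment> \<open>The \<open>(a x + b) y\<close> component of the square of the twisted element,
    without the two cross terms, which are equal and cancel. Its degree is
    \<open>card T - 1\<close>, so the weighted sum reads off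
    \<open>\<eta>\<^sup>2 a\<close>.\<close>
  define Q where "Q = monom (\<eta>\<^sup>2) (2 * m - 2) * h"
  have "degree Q \<le> 2 * m - 2 + 1"
    unfolding Q_def using degree_mult_le[of "monom (\<eta>\<^sup>2) (2 * m - 2)" h] a \<eta>
    by (simp add: degree_monom_eq)
  then have "(\<Sum>c\<in>T. node_weight T c * poly Q c) = coeff Q (card T - 1)"
    using T m c by (intro sum_node_weight_poly finite_T) auto
  also have "coeff Q (card T - 1) = \<eta>\<^sup>2 * a"
    unfolding Q_def coeff_monom_mult using T m by (simp add: m_eq)
  finally have Q: "(\<Sum>c\<in>T. node_weight T c * poly Q c) = \<eta>\<^sup>2 * a" .
  have "pairing U (monom 1 m, monom \<eta> (m - 1)) (monom 1 m, monom \<eta> (m - 1)) = 0"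
    using e by (intro orth) auto
  moreover have "poly (monom 1 m * monom \<eta> (m - 1) + monom 1 m * monom \<eta> (m - 1)
      + monom \<eta> (m - 1) * monom \<eta> (m - 1) * h) c = poly Q c" for c
    using m unfolding poly_add add_self
    by (simp add: Q_def mult_monom power2_eq_square del: mult_pCons_right)
      (simp add: m_eq flip: mult_2)
  ultimately have "(\<Sum>c\<in>T. trace_sum_y U c * poly Q c) = 0"
    unfolding pairing_eq by (simp only:) (simp add: M)
  then have "r * (\<eta>\<^sup>2 * a) = 0"
    unfolding Q[symmetric] by (simp add: r sum_distrib_left mult.assoc)
  then have "r = 0"
    using \<eta> a by simp
  then show "trace_sum U c = 0" "trace_sum_y U c = 0"
    using M r c by simp_all
qed

lemma pairing_node_weight:
  assumes "\<And>c. c \<in> T \<Longrightarrow> trace_sum U c = 0"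
    and "\<And>c. c \<in> T \<Longrightarrow> trace_sum_y U c = r * node_weight T c"
    and "T \<noteq> {}" and "degree (p * q' + p' * q + q * q' * h) < card T"
  shows "pairing U (p, q) (p', q') = r * coeff (p * q' + p' * q + q * q' * h) (card T - 1)"
  unfolding pairing_eq sum_node_weight_poly[OF finite_T assms(3,4), symmetric]
  using assms(1,2) by (simp add: sum_distrib_left mult.assoc del: poly_add poly_mult)

lemma degree_mult_h: "degree (q * h) \<le> degree q + 1"
  using degree_mult_le[of q h] a by simp

lemma odd_space_orthogonal:
  assumes T: "card T = 2 * m + 1"
    and M: "\<And>c. c \<in> T \<Longrightarrow> trace_sum U c = 0"
    and N: "\<And>c. c \<in> T \<Longrightarrow> trace_sum_y U c = r * node_weight T c"
    and g: "g \<in> odd_space \<eta> m" "g' \<in> odd_space \<eta> m"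
  shows "pairing U g g' = 0"
proof -
  obtain p q p' q' where gg: "g = (p, q)" "g' = (p', q')"
    by (metis surj_pair)
  have d: "degree p \<le> m + 1" "degree q < m" "coeff p (m + 1) = \<eta> * coeff q (m - 1)"
    "degree p' \<le> m + 1" "degree q' < m" "coeff p' (m + 1) = \<eta> * coeff q' (m - 1)"
    using g unfolding gg odd_space_def by auto
  \<comment> \<open>Every term has degree at most \<open>2 m = card T - 1\<close>, and the one with
    \<open>h\<close> stays strictly below, so it cannot contribute to the top coefficient.\<close>
  have deg: "degree (p * q') \<le> 2 * m" "degree (p' * q) \<le> 2 * m" "degree (q * q' * h) < 2 * m"
    using degree_mult_le[of p q'] degree_mult_le[of p' q] degree_mult_le[of q q']
      degree_mult_h[of "q * q'"] d by linarith+
  then have "degree (p * q' + p' * q + q * q' * h) \<le> 2 * m"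
    by (intro degree_add_le) auto
  moreover have "T \<noteq> {}"
    using T by auto
  ultimately have "pairing U g g' = r * coeff (p * q' + p' * q + q * q' * h) (card T - 1)"
    unfolding gg using M N T by (intro pairing_node_weight) auto
  moreover have e: "2 * m = (m + 1) + (m - 1)" and q: "degree q \<le> m - 1" "degree q' \<le> m - 1"
    using d(2,5) by auto
  \<comment> \<open>The twist relations turn both cross terms into the same expression, symmetric in
    the two elements; equal terms cancel in characteristic 2.\<close>
  have c: "coeff (p * q') (2 * m) = \<eta> * coeff q (m - 1) * coeff q' (m - 1)"
    "coeff (p' * q) (2 * m) = \<eta> * coeff q (m - 1) * coeff q' (m - 1)"
    using coeff_mult_top[OF d(1) q(2), folded e] coeff_mult_top[OF d(4) q(1), folded e] d(3,6)
    by simp_all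
  have "coeff (p * q' + p' * q + q * q' * h) (2 * m) = 0"
    unfolding coeff_add coeff_eq_0[OF deg(3)] c by (simp only: add_self add_0)
  moreover have "card T - 1 = 2 * m"
    using T by simp
  ultimately show ?thesis
    by (simp only: mult_zero_right)
qed

text \<open>Any \<open>g\<close> on the points is interpolated by some pair \<open>(p0, q0)\<close>.
  Orthogonality to the \<open>x^i\<close> bounds the degree of \<open>q0\<close>, to the
  \<open>x^i (a x + b) y\<close> that of \<open>p0\<close>, and to the twisted element it forces the
  twist relation.\<close>

lemma odd_space_self_dual:
  fixes g :: "'k \<Rightarrow> 'k \<Rightarrow> 'k"
  assumes T: "card T = 2 * m + 1" and m: "m \<ge> 1"
    and M: "\<And>c. c \<in> T \<Longrightarrow> trace_sum U c = 0"
    and N: "\<And>c. c \<in> T \<Longrightarrow> trace_sum_y U c = r * node_weight T c" and r: "r \<noteq> 0"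
    and orth: "\<And>p q. (p, q) \<in> odd_space \<eta> m \<Longrightarrow>
      (\<Sum>c\<in>T. U c (\<beta>\<^sub>0 c) * (g c (\<beta>\<^sub>0 c) * cval c (\<beta>\<^sub>0 c) p q)
        + U c (\<beta>\<^sub>0 c + 1) * (g c (\<beta>\<^sub>0 c + 1) * cval c (\<beta>\<^sub>0 c + 1) p q)) = 0"
  obtains p q where "(p, q) \<in> odd_space \<eta> m"
    and "\<And>c d. c \<in> T \<Longrightarrow> d \<in> {\<beta>\<^sub>0 c, \<beta>\<^sub>0 c + 1} \<Longrightarrow> g c d = cval c d p q"
proof -
  have ne: "T \<noteq> {}"
    using T by auto
  \<comment> \<open>The two values of \<open>p + q (a x + b) y\<close> on a fibre differ by
    \<open>q(c) (a c + b)\<close>, which determines \<open>q0\<close>; then \<open>p0\<close> is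
    found from one of the two values.\<close>
  obtain q0 where q0: "degree q0 < card T"
    "\<And>c. c \<in> T \<Longrightarrow> poly q0 c = (g c (\<beta>\<^sub>0 c) + g c (\<beta>\<^sub>0 c + 1)) / (a * c + b)"
    using interpolation[OF finite_T ne, of "\<lambda>c. (g c (\<beta>\<^sub>0 c) + g c (\<beta>\<^sub>0 c + 1)) / (a * c + b)"] by blast
  obtain p0 where p0: "degree p0 < card T"
    "\<And>c. c \<in> T \<Longrightarrow> poly p0 c = g c (\<beta>\<^sub>0 c) + poly q0 c * ((a * c + b) * \<beta>\<^sub>0 c)"
    using interpolation[OF finite_T ne, of "\<lambda>c. g c (\<beta>\<^sub>0 c) + poly q0 c * ((a * c + b) * \<beta>\<^sub>0 c)"] by blast
  have g: "g c d = cval c d p0 q0" if "c \<in> T" "d \<in> {\<beta>\<^sub>0 c, \<beta>\<^sub>0 c + 1}" for c d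
  proof -
    have z: "cval c (\<beta>\<^sub>0 c) p0 q0 = g c (\<beta>\<^sub>0 c)"
      unfolding curve_value_def p0(2)[OF that(1)] by (metis add.assoc add.right_neutral add_self)
    have "cval c (\<beta>\<^sub>0 c + 1) p0 q0 = cval c (\<beta>\<^sub>0 c) p0 q0 + poly q0 c * (a * c + b)"
      unfolding curve_value_def by (simp add: algebra_simps)
    also have "\<dots> = g c (\<beta>\<^sub>0 c) + (g c (\<beta>\<^sub>0 c) + g c (\<beta>\<^sub>0 c + 1))"
      unfolding z q0(2)[OF that(1)] using denominator[OF that(1)] by simp
    also have "\<dots> = g c (\<beta>\<^sub>0 c + 1)"
      by (metis add.assoc add_0 add_self)
    finally show ?thesis
      using z that(2) by auto
  qed
  have orth': "pairing U (p0, q0) (p, q) = 0" if "(p, q) \<in> odd_space \<eta> m" for p q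
    using orth[OF that] unfolding pairing_def prod.case by (simp add: g cong: sum.cong)
  have w: "(\<Sum>c\<in>T. node_weight T c * poly (p0 * q + p * q0 + q0 * q * h) c) = 0"
    if "(p, q) \<in> odd_space \<eta> m" for p q
  proof -
    have "(\<Sum>c\<in>T. trace_sum_y U c * poly (p0 * q + p * q0 + q0 * q * h) c) = 0"
      using orth'[OF that] M unfolding pairing_eq by simp
    then have "r * (\<Sum>c\<in>T. node_weight T c * poly (p0 * q + p * q0 + q0 * q * h) c) = 0"
      using N by (simp add: sum_distrib_left mult.assoc del: poly_add poly_mult)
    then show ?thesis
      using r by simp
  qed
  \<comment> \<open>The \<open>m + 1\<close> exponents \<open>0, ..., m\<close> leave degree below
    \<open>m\<close>. This bound comes first because the next step has to discard a term containing
    \<open>q0\<close>.\<close>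
  have "degree q0 < card T - (m + 1)"
  proof (rule degree_less_if_moments_eq_0[OF finite_T ne q0(1)])
    fix i assume "i < m + 1"
    then have "(monom 1 i, 0) \<in> odd_space \<eta> m"
      using m by (auto simp: odd_space_def degree_monom_eq)
    then show "(\<Sum>c\<in>T. node_weight T c * (c ^ i * poly q0 c)) = 0"
      using w by (fastforce simp: poly_monom)
  qed (use T m in simp)
  then have q0_deg: "degree q0 < m"
    using T by simp
  \<comment> \<open>Only the \<open>m - 1\<close> untwisted multiples of \<open>(a x + b) y\<close>
    are available, which leaves degree at most \<open>m + 1\<close>. The extra summand
    \<open>q0 x^i h\<close> has degree below \<open>card T - 1\<close>, so its weighted sum is
    zero.\<close>
  have "degree p0 < card T - (m - 1)"
  proof (rule degree_less_if_moments_eq_0[OF finite_T ne p0(1)])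
    fix i assume i: "i < m - 1"
    then have "(0, monom 1 i) \<in> odd_space \<eta> m"
      by (auto simp: odd_space_def degree_monom_eq)
    then have "(\<Sum>c\<in>T. node_weight T c * poly (p0 * monom 1 i + 0 * q0 + q0 * monom 1 i * h) c) = 0"
      by (rule w)
    then have "(\<Sum>c\<in>T. node_weight T c * (c ^ i * poly p0 c))
        + (\<Sum>c\<in>T. node_weight T c * poly (q0 * monom 1 i * h) c) = 0"
      unfolding poly_add distrib_left sum.distrib by (simp add: poly_monom mult_ac)
    moreover have deg: "degree (q0 * monom 1 i * h) < 2 * m"
      using degree_mult_h[of "q0 * monom 1 i"] degree_mult_le[of q0 "monom 1 i"] q0_deg i
      by (simp add: degree_monom_eq)
    then have "degree (q0 * monom 1 i * h) < card T" "card T - 1 = 2 * m"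
      using T by linarith+
    then have "(\<Sum>c\<in>T. node_weight T c * poly (q0 * monom 1 i * h) c) = 0"
      using sum_node_weight_poly[OF finite_T ne, of "q0 * monom 1 i * h"] coeff_eq_0[OF deg]
      by (simp only:)
    ultimately show "(\<Sum>c\<in>T. node_weight T c * (c ^ i * poly p0 c)) = 0"
      by simp
  qed (use T in simp)
  then have p0_deg: "degree p0 \<le> m + 1"
    using T m by simp
  \<comment> \<open>The twisted element is the remaining test: the coefficient of
    \<open>x^(2 m)\<close> in \<open>Q\<close> is
    \<open>coeff p0 (m + 1) + \<eta> * coeff q0 (m - 1)\<close>, and in characteristic 2 its
    vanishing is the twist relation.\<close>
  have "(monom \<eta> (m + 1), monom 1 (m - 1)) \<in> odd_space \<eta> m"
    using m by (auto simp: odd_space_def degree_monom_eq intro: order_trans[OF degree_monom_le])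
  note top = w[OF this]
  define Q where "Q = p0 * monom 1 (m - 1) + monom \<eta> (m + 1) * q0 + q0 * monom 1 (m - 1) * h"
  have deg: "degree (p0 * monom 1 (m - 1)) \<le> 2 * m" "degree (monom \<eta> (m + 1) * q0) \<le> 2 * m"
    "degree (q0 * monom 1 (m - 1) * h) < 2 * m"
    using degree_mult_le[of p0 "monom 1 (m - 1)"] degree_mult_le[of "monom \<eta> (m + 1)" q0]
      degree_mult_h[of "q0 * monom 1 (m - 1)"] degree_mult_le[of q0 "monom 1 (m - 1)"]
      degree_monom_le[of \<eta> "m + 1"] degree_monom_le[of "1::'k" "m - 1"] p0_deg q0_deg m
    by linarith+
  then have "degree Q \<le> 2 * m"
    unfolding Q_def by (intro degree_add_le) auto
  then have "coeff Q (2 * m) = 0"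
    using top sum_node_weight_poly[OF finite_T ne, of Q] T unfolding Q_def by simp
  moreover have c1: "coeff (p0 * monom 1 (m - 1)) (2 * m) = coeff p0 (m + 1)"
    using m by (simp add: mult.commute[of p0] coeff_monom_mult)
  moreover have c2: "coeff (monom \<eta> (m + 1) * q0) (2 * m) = \<eta> * coeff q0 (m - 1)"
    using m by (simp add: coeff_monom_mult)
  ultimately have "coeff p0 (m + 1) + \<eta> * coeff q0 (m - 1) = 0"
    unfolding Q_def coeff_add coeff_eq_0[OF deg(3)] c1 c2 by simp
  then have "(p0, q0) \<in> odd_space \<eta> m"
    using p0_deg q0_deg eq_iff_add unfolding odd_space_def by auto
  then show thesis
    using that g by blast
qed

end

subsection \<open>The twisted code\<close>

lemma poly_sum_monom:
  fixes A :: "nat \<Rightarrow> 'a::comm_ring_1"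
  shows "poly (\<Sum>i=0..n. monom (A i) i) c = (\<Sum>i=0..n. A i * c ^ i)"
  by (simp add: poly_sum poly_monom)

lemma coeff_sum_monom:
  fixes A :: "nat \<Rightarrow> 'a::comm_ring_1"
  shows "coeff (\<Sum>i=0..n. monom (A i) i) j = (if j \<le> n then A j else 0)"
  by (simp add: coeff_sum coeff_monom if_distrib cong: if_cong)

lemma degree_sum_monom:
  fixes A :: "nat \<Rightarrow> 'a::comm_ring_1"
  shows "degree (\<Sum>i=0..n. monom (A i) i) \<le> n"
  by (rule degree_le) (simp add: coeff_sum_monom)

lemma poly_as_sum_atMost:
  fixes p :: "'a::comm_ring_1 poly"
  assumes "degree p \<le> n"
  shows "poly p c = (\<Sum>i=0..n. coeff p i * c ^ i)"
  using poly_as_sum_below[of p "Suc n"] assms by (simp add: atLeast0AtMost lessThan_Suc_atMost)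

context point
begin

lemma val_combination:
  "val ((\<Sum>i=0..n. emb (A i) * x ^ i) + (\<Sum>j=0..n'. emb (B j) * x ^ j * (emb a * x + emb b) * y)
      + emb r * emb r' * x ^ m)
    = (\<Sum>i=0..n. A i * \<alpha> ^ i) + (\<Sum>j=0..n'. B j * \<alpha> ^ j) * ((a * \<alpha> + b) * \<beta>) + r * r' * \<alpha> ^ m"
proof -
  have 1: "emb (A i) * x ^ i \<in> R" "val (emb (A i) * x ^ i) = A i * \<alpha> ^ i" for i
    using x_in_R val_x by simp_all
  have 2: "emb (B j) * x ^ j * (emb a * x + emb b) * y \<in> R"
    "val (emb (B j) * x ^ j * (emb a * x + emb b) * y) = B j * \<alpha> ^ j * ((a * \<alpha> + b) * \<beta>)" for j
    using x_in_R val_x y_in_R val_y by (simp_all add: mult.assoc)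
  have 3: "emb r * emb r' * x ^ m \<in> R" "val (emb r * emb r' * x ^ m) = r * r' * \<alpha> ^ m"
    using x_in_R val_x by simp_all
  show ?thesis
    using 1(1) 2(1) 3(1) by (simp only: val_add val_sum R_add R_sum 1(2) 2(2) 3(2) sum_distrib_right)
qed

lemma val_combination':
  "val ((\<Sum>i=0..n. emb (A i) * x ^ i) + (\<Sum>j=0..n'. emb (B j) * x ^ j * (emb a * x + emb b) * y)
      + emb r * emb r' * x ^ m * (emb a * x + emb b) * y)
    = (\<Sum>i=0..n. A i * \<alpha> ^ i)
      + ((\<Sum>j=0..n'. B j * \<alpha> ^ j) + r * r' * \<alpha> ^ m) * ((a * \<alpha> + b) * \<beta>)"
proof -
  have 1: "emb (A i) * x ^ i \<in> R" "val (emb (A i) * x ^ i) = A i * \<alpha> ^ i" for i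
    using x_in_R val_x by simp_all
  have 2: "emb (B j) * x ^ j * (emb a * x + emb b) * y \<in> R"
    "val (emb (B j) * x ^ j * (emb a * x + emb b) * y) = B j * \<alpha> ^ j * ((a * \<alpha> + b) * \<beta>)" for j
    using x_in_R val_x y_in_R val_y by (simp_all add: mult.assoc)
  have 3: "emb r * emb r' * x ^ m * (emb a * x + emb b) * y \<in> R"
    "val (emb r * emb r' * x ^ m * (emb a * x + emb b) * y) = r * r' * \<alpha> ^ m * ((a * \<alpha> + b) * \<beta>)"
    using x_in_R val_x y_in_R val_y by (simp_all add: mult.assoc)
  show ?thesis
    using 1(1) 2(1) 3(1)
    by (simp only: val_add val_sum R_add R_sum 1(2) 2(2) 3(2) sum_distrib_right distrib_right add.assoc)
qed

end

lemma twisted_code_odd: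
  assumes pt: "\<And>i. i < n \<Longrightarrow> point emb x y a b (P i) (\<alpha> i) (\<beta> i)"
    and k: "k = 2 * m + 1" and m: "m \<ge> 1" and l: "l = m - 1"
  shows "twisted_code emb x y a b n P k l \<eta> v =
    {vec n (\<lambda>i. v $ i * curve_value a b (\<alpha> i) (\<beta> i) p q) | p q. (p, q) \<in> odd_space \<eta> m}"
    (is "?C = ?D")
proof -
  have idx: "odd k" "(k - 1) div 2 = m" "(k - 3) div 2 = m - 1" "(k + 1) div 2 = m + 1"
    using k m by auto
  define g where "g A B = (\<Sum>i=0..m. emb (A i) * x ^ i)
      + (\<Sum>j=0..m - 1. emb (B j) * x ^ j * (emb a * x + emb b) * y)
      + emb (B l) * emb \<eta> * x ^ (m + 1)" for A B
  have C: "?C = {vec n (\<lambda>i. v $ i * place_eval emb (P i) (g A B)) | A B. True}"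
    unfolding twisted_code_def twisted_space_def idx if_P[OF idx(1)] g_def by blast
  have val_g: "place_eval emb (P i) (g A B)
      = (\<Sum>i'=0..m. A i' * \<alpha> i ^ i') + (\<Sum>j=0..m - 1. B j * \<alpha> i ^ j) * ((a * \<alpha> i + b) * \<beta> i)
        + B l * \<eta> * \<alpha> i ^ (m + 1)" if "i < n" for i A B
    unfolding g_def by (rule point.val_combination[OF pt[OF that]])
  show ?thesis
  proof (intro equalityI subsetI)
    fix w assume "w \<in> ?C"
    then obtain A B where w: "w = vec n (\<lambda>i. v $ i * place_eval emb (P i) (g A B))"
      unfolding C by blast
    define p where "p = (\<Sum>i=0..m. monom (A i) i) + monom (B l * \<eta>) (m + 1)"
    define q where "q = (\<Sum>j=0..m - 1. monom (B j) j)"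
    have "degree p \<le> m + 1"
      unfolding p_def using degree_sum_monom[of A m] degree_monom_le[of "B l * \<eta>" "m + 1"]
      by (intro degree_add_le) auto
    moreover have "degree q < m"
      unfolding q_def using degree_sum_monom[of B "m - 1"] m by simp
    moreover have "coeff p (m + 1) = \<eta> * coeff q (m - 1)"
      unfolding p_def q_def l by (simp add: coeff_sum_monom mult.commute)
    ultimately have "(p, q) \<in> odd_space \<eta> m"
      unfolding odd_space_def by simp
    moreover have "w = vec n (\<lambda>i. v $ i * curve_value a b (\<alpha> i) (\<beta> i) p q)"
      unfolding w using val_g
      by (auto simp: curve_value_def p_def q_def poly_sum_monom poly_monom)
    ultimately show "w \<in> ?D"
      by blast
  next
    fix w assume "w \<in> ?D"
    then obtain p q where w: "w = vec n (\<lambda>i. v $ i * curve_value a b (\<alpha> i) (\<beta> i) p q)"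
      and "(p, q) \<in> odd_space \<eta> m"
      by blast
    then have pq: "degree p \<le> Suc m" "degree q \<le> m - 1" "coeff p (Suc m) = \<eta> * coeff q (m - 1)"
      unfolding odd_space_def by auto
    have "w = vec n (\<lambda>i. v $ i * place_eval emb (P i) (g (coeff p) (coeff q)))"
      unfolding w using val_g
      by (auto simp: curve_value_def poly_as_sum_atMost[OF pq(1)] poly_as_sum_atMost[OF pq(2)] pq(3) l)
    then show "w \<in> ?C"
      unfolding C by blast
  qed
qed

lemma twisted_code_even:
  assumes pt: "\<And>i. i < n \<Longrightarrow> point emb x y a b (P i) (\<alpha> i) (\<beta> i)"
    and k: "k = 2 * m" and m: "m \<ge> 2" and l: "l = m"
  shows "twisted_code emb x y a b n P k l \<eta> v =
    {vec n (\<lambda>i. v $ i * curve_value a b (\<alpha> i) (\<beta> i) p q) | p q. (p, q) \<in> even_space \<eta> m}"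
    (is "?C = ?D")
proof -
  have idx: "\<not> odd k" "k div 2 = m" "(k - 4) div 2 = m - 2" "(k - 2) div 2 = m - 1"
    using k m by auto
  \<comment> \<open>In this form the twisted monomial is the next summand after the sum up to
    \<open>m - 2\<close>.\<close>
  have m': "m - 1 = Suc (m - 2)"
    using m by simp
  define g where "g A B = (\<Sum>i=0..m. emb (A i) * x ^ i)
      + (\<Sum>j=0..m - 2. emb (B j) * x ^ j * (emb a * x + emb b) * y)
      + emb (A l) * emb \<eta> * x ^ (m - 1) * (emb a * x + emb b) * y" for A B
  have C: "?C = {vec n (\<lambda>i. v $ i * place_eval emb (P i) (g A B)) | A B. True}"
    unfolding twisted_code_def twisted_space_def idx if_not_P[OF idx(1)] g_def by blast
  have val_g: "place_eval emb (P i) (g A B)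
      = (\<Sum>i'=0..m. A i' * \<alpha> i ^ i')
        + ((\<Sum>j=0..m - 2. B j * \<alpha> i ^ j) + A l * \<eta> * \<alpha> i ^ (m - 1)) * ((a * \<alpha> i + b) * \<beta> i)"
    if "i < n" for i A B
    unfolding g_def by (rule point.val_combination'[OF pt[OF that]])
  show ?thesis
  proof (intro equalityI subsetI)
    fix w assume "w \<in> ?C"
    then obtain A B where w: "w = vec n (\<lambda>i. v $ i * place_eval emb (P i) (g A B))"
      unfolding C by blast
    define p where "p = (\<Sum>i=0..m. monom (A i) i)"
    define q where "q = (\<Sum>j=0..m - 2. monom (B j) j) + monom (A l * \<eta>) (m - 1)"
    have "degree q \<le> m - 1"
      unfolding q_def using degree_sum_monom[of B "m - 2"] degree_monom_le[of "A l * \<eta>" "m - 1"]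
      by (intro degree_add_le) auto
    moreover have "degree p \<le> m"
      unfolding p_def by (rule degree_sum_monom)
    moreover have "coeff q (m - 1) = \<eta> * coeff p m"
      unfolding p_def q_def l m' by (simp add: coeff_sum_monom mult.commute)
    ultimately have "(p, q) \<in> even_space \<eta> m"
      using m unfolding even_space_def by auto
    moreover have "w = vec n (\<lambda>i. v $ i * curve_value a b (\<alpha> i) (\<beta> i) p q)"
      unfolding w using val_g
      by (auto simp: curve_value_def p_def q_def poly_sum_monom poly_monom)
    ultimately show "w \<in> ?D"
      by blast
  next
    fix w assume "w \<in> ?D"
    then obtain p q where w: "w = vec n (\<lambda>i. v $ i * curve_value a b (\<alpha> i) (\<beta> i) p q)"
      and "(p, q) \<in> even_space \<eta> m"
      by blast
    then have pq: "degree p \<le> m" "degree q \<le> Suc (m - 2)" "coeff q (Suc (m - 2)) = \<eta> * coeff p m"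
      using m unfolding even_space_def m' by auto
    have "w = vec n (\<lambda>i. v $ i * place_eval emb (P i) (g (coeff p) (coeff q)))"
      unfolding w using val_g[unfolded m']
      by (intro eq_vecI) (simp_all add: curve_value_def poly_as_sum_atMost[OF pq(1)]
          poly_as_sum_atMost[OF pq(2)] pq(3) l)
    then show "w \<in> ?C"
      unfolding C by blast
  qed
qed

section \<open>Codewords as functions on the points over \<open>T\<close>\<close>

locale indexed_points = curve_points +
  fixes n :: nat and \<alpha> \<beta> :: "nat \<Rightarrow> 'a" and v :: "'a vec"
  assumes bij: "bij_betw (\<lambda>i. (\<alpha> i, \<beta> i)) {..<n} (SIGMA c:T. {\<beta>\<^sub>0 c, \<beta>\<^sub>0 c + 1})"
    and v_nz: "i < n \<Longrightarrow> v $ i \<noteq> 0"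
begin

text \<open>Inverting the numbering lets data given by position, such as \<open>v\<close> and a
  received word, be read as functions of the point, which the sums over fibres require.\<close>

definition index :: "'a \<Rightarrow> 'a \<Rightarrow> nat" where
  "index c d = the_inv_into {..<n} (\<lambda>i. (\<alpha> i, \<beta> i)) (c, d)"

lemma inj: "inj_on (\<lambda>i. (\<alpha> i, \<beta> i)) {..<n}"
  using bij by (rule bij_betw_imp_inj_on)

lemma index:
  assumes "c \<in> T" "d \<in> {\<beta>\<^sub>0 c, \<beta>\<^sub>0 c + 1}"
  shows "index c d < n" "\<alpha> (index c d) = c" "\<beta> (index c d) = d"
proof -
  have "(c, d) \<in> (\<lambda>i. (\<alpha> i, \<beta> i)) ` {..<n}"
    using assms bij_betw_imp_surj_on[OF bij] by auto
  then show "index c d < n" "\<alpha> (index c d) = c" "\<beta> (index c d) = d"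
    using the_inv_into_into[OF inj _ subset_refl, of "(c, d)"] f_the_inv_into_f[OF inj, of "(c, d)"]
    unfolding index_def by auto
qed

lemma index_point: "i < n \<Longrightarrow> index (\<alpha> i) (\<beta> i) = i"
  unfolding index_def using the_inv_into_f_f[OF inj, of i] by simp

lemma point_in: "i < n \<Longrightarrow> \<alpha> i \<in> T" "i < n \<Longrightarrow> \<beta> i \<in> {\<beta>\<^sub>0 (\<alpha> i), \<beta>\<^sub>0 (\<alpha> i) + 1}"
  using bij_betw_apply[OF bij] by auto

lemma sum_points: "(\<Sum>i<n. g (\<alpha> i) (\<beta> i)) = (\<Sum>c\<in>T. g c (\<beta>\<^sub>0 c) + g c (\<beta>\<^sub>0 c + 1))"
proof -
  have "(\<Sum>i<n. g (\<alpha> i) (\<beta> i)) = (\<Sum>(c, d)\<in>(SIGMA c:T. {\<beta>\<^sub>0 c, \<beta>\<^sub>0 c + 1}). g c d)"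
    using sum.reindex_bij_betw[OF bij, of "\<lambda>(c, d). g c d"] by simp
  also have "\<dots> = (\<Sum>c\<in>T. \<Sum>d\<in>{\<beta>\<^sub>0 c, \<beta>\<^sub>0 c + 1}. g c d)"
    using finite_T by (intro sum.Sigma[symmetric]) auto
  finally show ?thesis
    by simp
qed

text \<open>Both vectors in a scalar product carry the multiplier, hence the square.\<close>

definition weight :: "'a \<Rightarrow> 'a \<Rightarrow> 'a" where
  "weight c d = (v $ index c d)\<^sup>2"

abbreviation code :: "('a poly \<times> 'a poly) set \<Rightarrow> 'a vec set" where
  "code S \<equiv> {vec n (\<lambda>i. v $ i * cval (\<alpha> i) (\<beta> i) p q) | p q. (p, q) \<in> S}"

lemma scalar_prod_code:
  "vec n (\<lambda>i. v $ i * cval (\<alpha> i) (\<beta> i) p q) \<bullet> vec n (\<lambda>i. v $ i * g (\<alpha> i) (\<beta> i))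
    = (\<Sum>c\<in>T. weight c (\<beta>\<^sub>0 c) * (g c (\<beta>\<^sub>0 c) * cval c (\<beta>\<^sub>0 c) p q)
        + weight c (\<beta>\<^sub>0 c + 1) * (g c (\<beta>\<^sub>0 c + 1) * cval c (\<beta>\<^sub>0 c + 1) p q))"
proof -
  have "vec n (\<lambda>i. v $ i * cval (\<alpha> i) (\<beta> i) p q) \<bullet> vec n (\<lambda>i. v $ i * g (\<alpha> i) (\<beta> i))
      = (\<Sum>i<n. weight (\<alpha> i) (\<beta> i) * (g (\<alpha> i) (\<beta> i) * cval (\<alpha> i) (\<beta> i) p q))"
    unfolding scalar_prod_def
    by (intro sum.cong) (auto simp: weight_def index_point power2_eq_square)
  then show ?thesis
    using sum_points[of "\<lambda>c d. weight c d * (g c d * cval c d p q)"] by simp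
qed

lemma self_dual_imp_orthogonal:
  assumes "self_dual n (code S)" "g \<in> S" "g' \<in> S"
  shows "pairing weight g g' = 0"
proof -
  obtain p q p' q' where g: "g = (p, q)" "g' = (p', q')"
    by (metis surj_pair)
  have "vec n (\<lambda>i. v $ i * cval (\<alpha> i) (\<beta> i) p q) \<in> code S"
    "vec n (\<lambda>i. v $ i * cval (\<alpha> i) (\<beta> i) p' q') \<in> code S"
    using assms(2,3) unfolding g by blast+
  then have "vec n (\<lambda>i. v $ i * cval (\<alpha> i) (\<beta> i) p' q')
      \<bullet> vec n (\<lambda>i. v $ i * cval (\<alpha> i) (\<beta> i) p q) = 0"
    using assms(1) unfolding self_dual_def euclidean_dual_def by blast
  then show ?thesis
    using scalar_prod_code[of p' q' "\<lambda>c d. cval c d p q"] unfolding g pairing_def prod.case by simp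
qed

lemma weight_nonzero:
  assumes "c \<in> T" "d \<in> {\<beta>\<^sub>0 c, \<beta>\<^sub>0 c + 1}"
  shows "weight c d \<noteq> 0"
  using v_nz[OF index(1)[OF assms]] by (simp add: weight_def)

lemma square_eq_weight: "i < n \<Longrightarrow> (v $ i)\<^sup>2 = weight (\<alpha> i) (\<beta> i)"
  by (simp add: weight_def index_point)

lemma odd_code_self_dual_imp:
  assumes T: "card T = 2 * m + 1" and m: "m \<ge> 1" and sd: "self_dual n (code (odd_space \<eta> m))"
  shows "\<exists>r. r \<noteq> 0 \<and> (\<forall>i<n. (v $ i)\<^sup>2 = r * node_weight T (\<alpha> i) / (a * \<alpha> i + b))"
proof -
  obtain r where M: "\<And>c. c \<in> T \<Longrightarrow> trace_sum weight c = 0"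
    and N: "\<And>c. c \<in> T \<Longrightarrow> trace_sum_y weight c = r * node_weight T c"
    using odd_orthogonal_imp[OF T m self_dual_imp_orthogonal[OF sd]] by blast
  have w: "weight c d = r * node_weight T c / (a * c + b)" if "c \<in> T" "d \<in> {\<beta>\<^sub>0 c, \<beta>\<^sub>0 c + 1}" for c d
    using weights_eq[where U = weight, OF that(1) M[OF that(1)] N[OF that(1)] that(2)] .
  obtain c where "c \<in> T"
    using T by fastforce
  then have "r \<noteq> 0"
    using w[of c "\<beta>\<^sub>0 c"] weight_nonzero[of c "\<beta>\<^sub>0 c"] by auto
  moreover have "(v $ i)\<^sup>2 = r * node_weight T (\<alpha> i) / (a * \<alpha> i + b)" if "i < n" for i
    unfolding square_eq_weight[OF that] using point_in[OF that] by (rule w)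
  ultimately show ?thesis
    by blast
qed

lemma odd_code_self_dual:
  assumes T: "card T = 2 * m + 1" and m: "m \<ge> 1" and r: "r \<noteq> 0"
    and v: "\<And>i. i < n \<Longrightarrow> (v $ i)\<^sup>2 = r * node_weight T (\<alpha> i) / (a * \<alpha> i + b)"
  shows "self_dual n (code (odd_space \<eta> m))"
proof -
  have w: "weight c d = r * node_weight T c / (a * c + b)" if "c \<in> T" "d \<in> {\<beta>\<^sub>0 c, \<beta>\<^sub>0 c + 1}" for c d
    using v[OF index(1)[OF that]] index(2)[OF that] by (simp add: weight_def)
  have MN: "trace_sum weight c = 0" "trace_sum_y weight c = r * node_weight T c" if "c \<in> T" for c
    using trace_sums_of_weights[OF that, of weight "r * node_weight T c"] w[OF that] by simp_all
  show ?thesis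
    unfolding self_dual_def
  proof (intro equalityI subsetI)
    fix w assume "w \<in> code (odd_space \<eta> m)"
    then obtain p q where w: "w = vec n (\<lambda>i. v $ i * cval (\<alpha> i) (\<beta> i) p q)"
      and pq: "(p, q) \<in> odd_space \<eta> m"
      by blast
    have "vec n (\<lambda>i. v $ i * cval (\<alpha> i) (\<beta> i) p' q') \<bullet> w = 0" if "(p', q') \<in> odd_space \<eta> m" for p' q'
    proof -
      have "pairing weight (p, q) (p', q') = 0"
        using odd_space_orthogonal[of m weight r, OF T _ _ pq that] MN by blast
      then show ?thesis
        unfolding w scalar_prod_code[of p' q' "\<lambda>c d. cval c d p q"] pairing_def prod.case .
    qed
    then show "w \<in> euclidean_dual n (code (odd_space \<eta> m))"
      unfolding euclidean_dual_def w by auto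
  next
    fix w assume w: "w \<in> euclidean_dual n (code (odd_space \<eta> m))"
    \<comment> \<open>The word with its multipliers divided out, as a function on the points; this
      is the function to be interpolated.\<close>
    define g where "g c d = w $ index c d / v $ index c d" for c d
    have w_eq: "w = vec n (\<lambda>i. v $ i * g (\<alpha> i) (\<beta> i))"
      using w v_nz unfolding euclidean_dual_def by (auto simp: g_def index_point)
    have orth: "(\<Sum>c\<in>T. weight c (\<beta>\<^sub>0 c) * (g c (\<beta>\<^sub>0 c) * cval c (\<beta>\<^sub>0 c) p q)
        + weight c (\<beta>\<^sub>0 c + 1) * (g c (\<beta>\<^sub>0 c + 1) * cval c (\<beta>\<^sub>0 c + 1) p q)) = 0"
      if "(p, q) \<in> odd_space \<eta> m" for p q
    proof -
      have "vec n (\<lambda>i. v $ i * cval (\<alpha> i) (\<beta> i) p q) \<bullet> w = 0"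
        using w that unfolding euclidean_dual_def by blast
      then show ?thesis
        unfolding w_eq scalar_prod_code[of p q g] .
    qed
    obtain p q where pq: "(p, q) \<in> odd_space \<eta> m"
      and g: "\<And>c d. c \<in> T \<Longrightarrow> d \<in> {\<beta>\<^sub>0 c, \<beta>\<^sub>0 c + 1} \<Longrightarrow> g c d = cval c d p q"
      using odd_space_self_dual[where U = weight and g = g, OF T m _ _ r orth] MN by blast
    have "w = vec n (\<lambda>i. v $ i * cval (\<alpha> i) (\<beta> i) p q)"
      unfolding w_eq using g[OF point_in] by auto
    then show "w \<in> code (odd_space \<eta> m)"
      using pq by blast
  qed
qed

lemma even_code_not_self_dual:
  assumes T: "card T = 2 * m" and m: "m \<ge> 2" and \<eta>: "\<eta> \<noteq> 0"
  shows "\<not> self_dual n (code (even_space \<eta> m))"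
proof
  assume sd: "self_dual n (code (even_space \<eta> m))"
  obtain c where c: "c \<in> T"
    using T m by fastforce
  have "weight c (\<beta>\<^sub>0 c) = 0 / (a * c + b)"
    using even_orthogonal_imp[OF T m \<eta> self_dual_imp_orthogonal[OF sd] c]
    by (intro weights_eq[OF c]) auto
  then show False
    using weight_nonzero[OF c] by simp
qed

lemma sum_constant_on_fibres:
  fixes g :: "'a \<Rightarrow> 'a"
  shows "(\<Sum>i<n. g (\<alpha> i)) = 0"
proof -
  have "(\<Sum>i<n. g (\<alpha> i)) = (\<Sum>c\<in>T. g c + g c)"
    by (rule sum_points)
  then show ?thesis
    by (simp only: add_self sum.neutral_const)
qed

lemma sum_top_moment:
  assumes "card T \<ge> 2"
  shows "(\<Sum>i<n. node_weight T (\<alpha> i) * (a * \<alpha> i + b) * \<alpha> i ^ (card T - 2) * \<beta> i) = a"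
proof -
  define p where "p = monom 1 (card T - 2) * h"
  have deg: "degree p < card T"
    unfolding p_def using degree_mult_le[of "monom 1 (card T - 2)" h] a assms
    by (simp add: degree_monom_eq)
  \<comment> \<open>On each fibre the two ordinates add up to 1, so the factor
    \<open>\<beta> i\<close> disappears and the top coefficient \<open>a\<close> of \<open>p\<close>
    remains to be read off.\<close>
  have eq: "z * d + z * (d + 1) = z" for z d :: 'a
  proof -
    have "z * d + z * (d + 1) = (z * d + z * d) + z"
      by (simp add: algebra_simps)
    then show ?thesis
      unfolding add_self by simp
  qed
  have "(\<Sum>i<n. node_weight T (\<alpha> i) * (a * \<alpha> i + b) * \<alpha> i ^ (card T - 2) * \<beta> i)
      = (\<Sum>c\<in>T. node_weight T c * (a * c + b) * c ^ (card T - 2))"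
    unfolding sum_points[of "\<lambda>c d. node_weight T c * (a * c + b) * c ^ (card T - 2) * d"] eq ..
  also have "\<dots> = (\<Sum>c\<in>T. node_weight T c * poly p c)"
    by (intro sum.cong) (simp_all add: p_def poly_monom algebra_simps)
  also have "\<dots> = coeff p (card T - 1)"
    using assms by (intro sum_node_weight_poly[OF finite_T _ deg]) auto
  also have "\<dots> = a"
    unfolding p_def coeff_monom_mult using assms by (auto simp: Suc_diff_le numeral_2_eq_2)
  finally show ?thesis .
qed

end

section \<open>From places of the function field to points over \<open>T\<close>\<close>

theorem mainTheorem10:
  fixes emb :: "'k::{finite,field} \<Rightarrow> 'f::field"
    and x y t :: 'f
    and a b \<eta> :: 'k
    and T :: "'k set"
    and k n l :: nat
    and P :: "nat \<Rightarrow> 'f set"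
    and \<alpha> \<beta> \<gamma> :: "nat \<Rightarrow> 'k"
    and v :: "'k vec"
  assumes field: "third_type_field emb x y a b"
    and k: "k \<ge> 3" and n: "n = 2 * k"
    and l: "l = (if odd k then (k - 3) div 2 else k div 2)"
    and T: "T \<subseteq> {c. a * c + b \<noteq> 0 \<and> card {d. d\<^sup>2 + d = c + 1 / (a * c + b)} = 2}"
    and card_T: "card T = k"
    and P: "bij_betw P {..<n}
              {Q. rational_place emb Q \<and> x \<in> ring_of_place Q \<and> place_eval emb Q x \<in> T}"
    and \<alpha>: "\<And>i. i < n \<Longrightarrow> \<alpha> i = place_eval emb (P i) x"
    and \<beta>: "\<And>i. i < n \<Longrightarrow> \<beta> i = place_eval emb (P i) y"
    and t: "t = (\<Prod>c\<in>T. x - emb c)"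
    and \<gamma>: "\<And>i. i < n \<Longrightarrow> \<gamma> i = residue_at emb (P i) (1 / t) x"
    and \<eta>: "\<eta> \<noteq> 0"
    and v: "v \<in> carrier_vec n" and v_nz: "\<And>i. i < n \<Longrightarrow> v $ i \<noteq> 0"
  shows
    "(odd k \<longrightarrow>
        (self_dual n (twisted_code emb x y a b n P k l \<eta> v) \<longleftrightarrow>
           (\<Sum>i<n. \<gamma> i / (a * \<alpha> i + b) * \<alpha> i ^ (k + 1)) = 0 \<and>
           (\<exists>c. c \<noteq> 0 \<and> (\<forall>i<n. (v $ i)\<^sup>2 = c * \<gamma> i / (a * \<alpha> i + b))))) \<and>
     (even k \<longrightarrow>
        (self_dual n (twisted_code emb x y a b n P k l \<eta> v) \<longleftrightarrow>
           (\<Sum>i<n. \<gamma> i * (a * \<alpha> i + b) * \<alpha> i ^ (k - 2) * \<beta> i) = 0 \<and>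
           (\<exists>c. c \<noteq> 0 \<and> (\<forall>i<n. (v $ i)\<^sup>2 = c * \<gamma> i / (a * \<alpha> i + b)))))"
proof -
  have hom: "field_hom emb"
    using field unfolding third_type_field_def by blast
  interpret F: third_type emb x y a b
    using hom field by (intro third_type.intro third_type_axioms.intro)
  have finite_T: "finite T"
    by simp
  have P_in: "rational_place emb (P i)" "x \<in> ring_of_place (P i)" "\<alpha> i \<in> T" if "i < n" for i
    using bij_betw_apply[OF P, of i] that \<alpha>[OF that] by auto
  have pt: "point emb x y a b (P i) (\<alpha> i) (\<beta> i)" if "i < n" for i
  proof -
    have "is_place emb (P i)"
      using P_in(1)[OF that] unfolding rational_place_def by blast
    moreover have "a * \<alpha> i + b \<noteq> 0"
      using P_in(3)[OF that] T by blast
    ultimately show ?thesis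
      using P_in[OF that] \<alpha>[OF that] \<beta>[OF that] hom F.third_type_axioms
      by (intro point.intro degree_one_place.intro place.intro place_axioms.intro
          degree_one_place_axioms.intro point_axioms.intro) auto
  qed
  define \<beta>\<^sub>0 where "\<beta>\<^sub>0 c = (SOME d. d\<^sup>2 + d = c + 1 / (a * c + b))" for c
  have curve: "(\<beta>\<^sub>0 c)\<^sup>2 + \<beta>\<^sub>0 c = c + 1 / (a * c + b)" if "c \<in> T" for c
  proof -
    have "card {d. d\<^sup>2 + d = c + 1 / (a * c + b)} = 2"
      using T that by blast
    then have "{d. d\<^sup>2 + d = c + 1 / (a * c + b)} \<noteq> {}"
      by (metis card.empty zero_neq_numeral)
    then show ?thesis
      unfolding \<beta>\<^sub>0_def by (metis (mono_tags, lifting) Collect_empty_eq someI_ex)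
  qed
  interpret C: curve_points a b T \<beta>\<^sub>0
    using F.two_eq_0(1) finite_T F.a_nonzero T curve by unfold_locales auto
  \<comment> \<open>Two solutions of the same equation \<open>d\<^sup>2 + d = z\<close> differ by 0
    or 1, by factoring the difference of the two equations.\<close>
  have fibre: "\<beta> i \<in> {\<beta>\<^sub>0 (\<alpha> i), \<beta>\<^sub>0 (\<alpha> i) + 1}" if "i < n" for i
  proof -
    have "(\<beta> i)\<^sup>2 + \<beta> i = (\<beta>\<^sub>0 (\<alpha> i))\<^sup>2 + \<beta>\<^sub>0 (\<alpha> i)"
      using point.val_curve[OF pt[OF that]] curve[OF P_in(3)[OF that]] by simp
    then have "(\<beta> i - \<beta>\<^sub>0 (\<alpha> i)) * (\<beta> i + \<beta>\<^sub>0 (\<alpha> i) + 1) = 0"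
      by (simp add: power2_eq_square algebra_simps)
    then have "\<beta> i = \<beta>\<^sub>0 (\<alpha> i) \<or> \<beta> i + (\<beta>\<^sub>0 (\<alpha> i) + 1) = 0"
      by (simp add: add.assoc)
    then show ?thesis
      using C.eq_iff_add by blast
  qed
  define points where "points = (SIGMA c:T. {\<beta>\<^sub>0 c, \<beta>\<^sub>0 c + 1})"
  \<comment> \<open>Different indices could only share coordinates if two different places lay over
    one point, which \<open>point_unique\<close> excludes.\<close>
  have inj: "inj_on (\<lambda>i. (\<alpha> i, \<beta> i)) {..<n}"
  proof (rule inj_onI)
    fix i j assume ij: "i \<in> {..<n}" "j \<in> {..<n}" "(\<alpha> i, \<beta> i) = (\<alpha> j, \<beta> j)"
    then have "point emb x y a b (P j) (\<alpha> i) (\<beta> i)" "i < n"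
      using pt[of j] by simp_all
    then have "P i = P j"
      using point_unique[OF pt] by blast
    then show "i = j"
      using P ij unfolding bij_betw_def inj_on_def by blast
  qed
  \<comment> \<open>There are as many places as points of the affine curve over \<open>T\<close>, so every point is hit.\<close>
  have "card points = n"
    unfolding points_def using finite_T by (simp add: card_SigmaI card_T n)
  moreover have "(\<lambda>i. (\<alpha> i, \<beta> i)) ` {..<n} \<subseteq> points"
    using P_in(3) fibre by (auto simp: points_def)
  moreover have "finite points"
    unfolding points_def using finite_T by auto
  ultimately have "(\<lambda>i. (\<alpha> i, \<beta> i)) ` {..<n} = points"
    using card_image[OF inj] by (intro card_subset_eq) auto
  then interpret I: indexed_points a b T \<beta>\<^sub>0 n \<alpha> \<beta> v
    using inj v_nz unfolding points_def by unfold_locales (auto simp: bij_betw_def)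
  have \<gamma>_eq: "\<gamma> i = node_weight T (\<alpha> i)" if "i < n" for i
    using point.residue_product[OF pt[OF that] finite_T P_in(3)[OF that]] \<gamma>[OF that]
    unfolding t node_weight_def by simp
  have v_iff: "(\<exists>c. c \<noteq> 0 \<and> (\<forall>i<n. (v $ i)\<^sup>2 = c * \<gamma> i / (a * \<alpha> i + b)))
      \<longleftrightarrow> (\<exists>c. c \<noteq> 0 \<and> (\<forall>i<n. (v $ i)\<^sup>2 = c * node_weight T (\<alpha> i) / (a * \<alpha> i + b)))"
    using \<gamma>_eq by simp
  have odd: "self_dual n (twisted_code emb x y a b n P k l \<eta> v) \<longleftrightarrow>
      (\<Sum>i<n. \<gamma> i / (a * \<alpha> i + b) * \<alpha> i ^ (k + 1)) = 0 \<and>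
      (\<exists>c. c \<noteq> 0 \<and> (\<forall>i<n. (v $ i)\<^sup>2 = c * \<gamma> i / (a * \<alpha> i + b)))" if "odd k"
  proof -
    obtain m where m: "k = 2 * m + 1"
      using \<open>odd k\<close> by (rule oddE)
    have m1: "m \<ge> 1" and l': "l = m - 1"
      using k l m by auto
    have "(\<Sum>i<n. \<gamma> i / (a * \<alpha> i + b) * \<alpha> i ^ (k + 1))
        = (\<Sum>i<n. node_weight T (\<alpha> i) / (a * \<alpha> i + b) * \<alpha> i ^ (k + 1))"
      using \<gamma>_eq by simp
    also have "\<dots> = 0"
      by (rule I.sum_constant_on_fibres)
    finally have sum: "(\<Sum>i<n. \<gamma> i / (a * \<alpha> i + b) * \<alpha> i ^ (k + 1)) = 0" .
    have card: "card T = 2 * m + 1"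
      using card_T m by simp
    have code: "twisted_code emb x y a b n P k l \<eta> v = I.code (odd_space \<eta> m)"
      by (rule twisted_code_odd[OF pt m m1 l'])
    have "self_dual n (I.code (odd_space \<eta> m)) \<longleftrightarrow>
        (\<exists>c. c \<noteq> 0 \<and> (\<forall>i<n. (v $ i)\<^sup>2 = c * node_weight T (\<alpha> i) / (a * \<alpha> i + b)))"
    proof
      assume "\<exists>c. c \<noteq> 0 \<and> (\<forall>i<n. (v $ i)\<^sup>2 = c * node_weight T (\<alpha> i) / (a * \<alpha> i + b))"
      then obtain c where "c \<noteq> 0"
        and "\<forall>i<n. (v $ i)\<^sup>2 = c * node_weight T (\<alpha> i) / (a * \<alpha> i + b)"
        by (elim exE conjE)
      then show "self_dual n (I.code (odd_space \<eta> m))"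
        by (intro I.odd_code_self_dual[OF card m1 \<open>c \<noteq> 0\<close>]) (simp only:)
    qed (rule I.odd_code_self_dual_imp[OF card m1])
    then show ?thesis
      unfolding v_iff code using sum by (simp only: simp_thms)
  qed
  have even: "self_dual n (twisted_code emb x y a b n P k l \<eta> v) \<longleftrightarrow>
      (\<Sum>i<n. \<gamma> i * (a * \<alpha> i + b) * \<alpha> i ^ (k - 2) * \<beta> i) = 0 \<and>
      (\<exists>c. c \<noteq> 0 \<and> (\<forall>i<n. (v $ i)\<^sup>2 = c * \<gamma> i / (a * \<alpha> i + b)))" if "even k"
  proof -
    obtain m where m: "k = 2 * m"
      using \<open>even k\<close> by (rule evenE)
    have m2: "m \<ge> 2" and l': "l = m"
      using k l m by auto
    have "(\<Sum>i<n. \<gamma> i * (a * \<alpha> i + b) * \<alpha> i ^ (k - 2) * \<beta> i) = a"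
      using I.sum_top_moment \<gamma>_eq card_T k by simp
    moreover have card: "card T = 2 * m"
      using card_T m by simp
    have code: "twisted_code emb x y a b n P k l \<eta> v = I.code (even_space \<eta> m)"
      by (rule twisted_code_even[OF pt m m2 l'])
    have "\<not> self_dual n (twisted_code emb x y a b n P k l \<eta> v)"
      unfolding code by (rule I.even_code_not_self_dual[OF card m2 \<eta>])
    ultimately show ?thesis
      using F.a_nonzero by (simp only: simp_thms)
  qed
  show ?thesis
    using odd even by blast
qed

end
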